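(* Let $G$ be a locally compact and $\sigma$-compact Hausdorff topological group. For each closed subgroup $H$ of $G$ let $\mathcal{I}^{\mathrm{Haar}}_H$ be the family of Haar-measure-null subsets of $H$, and let $\mathcal{I}^{\mathrm{Haar}}=\{\mathcal{I}^{\mathrm{Haar}}_H\}_H$. Then $\mathcal{I}^{\mathrm{Haar}}$ is a strongly admissible ideal scheme on $G$ (i.e. the independence relation induced by $\mathcal{I}^{\mathrm{Haar}}$ is a strongly admissible geometry for $G$).
   Context: For a closed subgroup $H$ of $G$ with left Haar measure $\mu_H$, a Borel set $X\subset H$ is null if $\mu_H(X)=0$; an arbitrary subset of $H$ is null if it is contained in a Borel null set. An ideal scheme $\mathcal{I}=\{\mathcal{I}_H\}_H$ of $G$ assigns to each closed subgroup $H$ of $G$ an ideal $\mathcal{I}_H$ of subsets of $H$. Below, $K<H$ means "$K$ is a subgroup of $H$" (not necessarily proper). The scheme is strongly admissible if: 1. ($\sigma$-ideal) every $\mathcal{I}_H$ is a $\sigma$-ideal; 2. (Invariance) every $\mathcal{I}_H$ is $H$-invariant (closed under translation by elements of $H$), and $g^{-1}\mathcal{I}_H g:=\{g^{-1}Xg:X\in\mathcal{I}_H\}=\mathcal{I}_{g^{-1}Hg}$ for every closed subgroup $H$ and $g\in G$; 3. (Transitivity) for all closed subgroups $K_1>K_2>K_3$ and $H<K_1$: [$(H\cap K_2)K_3\notin\mathcal{I}_{K_2}$ and $HK_2\notin\mathcal{I}_{K_1}$] if and only if $HK_3\notin\mathcal{I}_{K_1}$; 4. (Dichotomy for closed subgroups)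 for all closed subgroups $K<H$: $K\in\mathcal{I}_H$ if and only if $H/K$ is uncountable. When $\mathcal{I}$ is strongly admissible, the pair consisting of $G$ and its induced independence relation (defined on sets with a $G$-action with closed point stabilizers by: $a$ is independent from $b$ over $C$ iff $G_{Ca}G_{Cb}\notin\mathcal{I}_{G_C}$, where $G_A$ is the pointwise stabilizer of $A$) is called a strongly admissible geometry for $G$. *)

theory Defs
  imports
    "HOL-Analysis.Analysis"
    "HOL-Algebra.Left_Coset"
    "HOL-Algebra.Group_Action"
begin

section \<open>Topological groups\<close>

locale topological_group = group G for G (structure) +
  fixes T :: "'a topology"
  assumes topspace_eq: "topspace T = carrier G"
    and continuous_mult: "continuous_map (prod_topology T T) T (\<lambda>(x, y). x \<otimes> y)"
    and continuous_inv: "continuous_map T T (\<lambda>x. inv x)"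

definition sigma_compact_space :: "'a topology \<Rightarrow> bool" where
  "sigma_compact_space T \<longleftrightarrow>
     (\<exists>K :: nat \<Rightarrow> 'a set. (\<forall>n. compactin T (K n)) \<and> (\<Union>n. K n) = topspace T)"

definition closed_subgroup :: "('a, 'b) monoid_scheme \<Rightarrow> 'a topology \<Rightarrow> 'a set \<Rightarrow> bool" where
  "closed_subgroup G T H \<longleftrightarrow> subgroup H G \<and> closedin T H"


section \<open>Haar measure and Haar null sets\<close>

text \<open>
  A left Haar measure is a nonzero left invariant Radon measure on the Borel sets. Radon means
  finite on compact sets, outer regular on Borel sets and inner regular on open sets; without
  regularity there is no uniqueness up to scaling beyond the second countable case.
\<close>

definition left_haar_measure ::
    "('a, 'b) monoid_scheme \<Rightarrow> 'a topology \<Rightarrow> 'a measure \<Rightarrow> bool" where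
  "left_haar_measure G T M \<longleftrightarrow>
     sets M = sets (sigma (topspace T) {U. openin T U}) \<and>
     emeasure M (space M) \<noteq> 0 \<and>
     (\<forall>g \<in> carrier G. \<forall>B \<in> sets M. emeasure M (g <#\<^bsub>G\<^esub> B) = emeasure M B) \<and>
     (\<forall>K. compactin T K \<longrightarrow> emeasure M K < \<infinity>) \<and>
     (\<forall>B \<in> sets M. emeasure M B = (INF U \<in> {U. openin T U \<and> B \<subseteq> U}. emeasure M U)) \<and>
     (\<forall>U. openin T U \<longrightarrow> emeasure M U = (SUP K \<in> {K. compactin T K \<and> K \<subseteq> U}. emeasure M K))"

text \<open>
  On a locally compact Hausdorff group a left Haar measure exists and is unique up to a positive
  scalar, so the null sets below do not depend on the choice.
\<close>

definition haar_measure :: "('a, 'b) monoid_scheme \<Rightarrow> 'a topology \<Rightarrow> 'a measure" where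
  "haar_measure G T = (SOME M. left_haar_measure G T M)"

definition haar_null_sets :: "('a, 'b) monoid_scheme \<Rightarrow> 'a topology \<Rightarrow> 'a set set" where
  "haar_null_sets G T = {X. \<exists>B \<in> null_sets (haar_measure G T). X \<subseteq> B}"

definition haar_scheme :: "('a, 'b) monoid_scheme \<Rightarrow> 'a topology \<Rightarrow> 'a set \<Rightarrow> 'a set set" where
  "haar_scheme G T H = haar_null_sets (G\<lparr>carrier := H\<rparr>) (subtopology T H)"


section \<open>Strongly admissible ideal schemes\<close>

definition set_ideal :: "'a set \<Rightarrow> 'a set set \<Rightarrow> bool" where
  "set_ideal H J \<longleftrightarrow>
     J \<subseteq> Pow H \<and> {} \<in> J \<and>
     (\<forall>X \<in> J. \<forall>Y. Y \<subseteq> X \<longrightarrow> Y \<in> J) \<and>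
     (\<forall>X \<in> J. \<forall>Y \<in> J. X \<union> Y \<in> J)"

definition set_sigma_ideal :: "'a set \<Rightarrow> 'a set set \<Rightarrow> bool" where
  "set_sigma_ideal H J \<longleftrightarrow>
     set_ideal H J \<and> (\<forall>X :: nat \<Rightarrow> 'a set. (\<forall>n. X n \<in> J) \<longrightarrow> (\<Union>n. X n) \<in> J)"

text \<open>
  A scheme is a function on all sets of which only the values at closed subgroups matter.
\<close>

definition ideal_scheme ::
    "('a, 'b) monoid_scheme \<Rightarrow> 'a topology \<Rightarrow> ('a set \<Rightarrow> 'a set set) \<Rightarrow> bool" where
  "ideal_scheme G T I \<longleftrightarrow> (\<forall>H. closed_subgroup G T H \<longrightarrow> set_ideal H (I H))"

definition scheme_sigma_ideal ::
    "('a, 'b) monoid_scheme \<Rightarrow> 'a topology \<Rightarrow> ('a set \<Rightarrow> 'a set set) \<Rightarrow> bool" where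
  "scheme_sigma_ideal G T I \<longleftrightarrow> (\<forall>H. closed_subgroup G T H \<longrightarrow> set_sigma_ideal H (I H))"

definition scheme_invariance ::
    "('a, 'b) monoid_scheme \<Rightarrow> 'a topology \<Rightarrow> ('a set \<Rightarrow> 'a set set) \<Rightarrow> bool" where
  "scheme_invariance G T I \<longleftrightarrow>
     (\<forall>H. closed_subgroup G T H \<longrightarrow>
        (\<forall>h \<in> H. \<forall>X \<in> I H. h <#\<^bsub>G\<^esub> X \<in> I H \<and> X #>\<^bsub>G\<^esub> h \<in> I H) \<and>
        (\<forall>g \<in> carrier G.
           {inv\<^bsub>G\<^esub> g <#\<^bsub>G\<^esub> X #>\<^bsub>G\<^esub> g | X. X \<in> I H} = I (inv\<^bsub>G\<^esub> g <#\<^bsub>G\<^esub> H #>\<^bsub>G\<^esub> g)))"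

definition scheme_transitivity ::
    "('a, 'b) monoid_scheme \<Rightarrow> 'a topology \<Rightarrow> ('a set \<Rightarrow> 'a set set) \<Rightarrow> bool" where
  "scheme_transitivity G T I \<longleftrightarrow>
     (\<forall>K1 K2 K3 H.
        closed_subgroup G T K1 \<and> closed_subgroup G T K2 \<and>
        closed_subgroup G T K3 \<and> closed_subgroup G T H \<and>
        K3 \<subseteq> K2 \<and> K2 \<subseteq> K1 \<and> H \<subseteq> K1 \<longrightarrow>
        ((H \<inter> K2) <#>\<^bsub>G\<^esub> K3 \<notin> I K2 \<and> H <#>\<^bsub>G\<^esub> K2 \<notin> I K1 \<longleftrightarrow> H <#>\<^bsub>G\<^esub> K3 \<notin> I K1))"

definition scheme_dichotomy ::
    "('a, 'b) monoid_scheme \<Rightarrow> 'a topology \<Rightarrow> ('a set \<Rightarrow> 'a set set) \<Rightarrow> bool" where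
  "scheme_dichotomy G T I \<longleftrightarrow>
     (\<forall>H K. closed_subgroup G T H \<and> closed_subgroup G T K \<and> K \<subseteq> H \<longrightarrow>
        (K \<in> I H \<longleftrightarrow> uncountable (lcosets\<^bsub>G\<lparr>carrier := H\<rparr>\<^esub> K)))"

definition strongly_admissible ::
    "('a, 'b) monoid_scheme \<Rightarrow> 'a topology \<Rightarrow> ('a set \<Rightarrow> 'a set set) \<Rightarrow> bool" where
  "strongly_admissible G T I \<longleftrightarrow>
     ideal_scheme G T I \<and> scheme_sigma_ideal G T I \<and> scheme_invariance G T I \<and>
     scheme_transitivity G T I \<and> scheme_dichotomy G T I"


section \<open>The induced independence relation\<close>

definition pointwise_stabilizer ::
    "('a, 'b) monoid_scheme \<Rightarrow> ('a \<Rightarrow> 'x \<Rightarrow> 'x) \<Rightarrow> 'x set \<Rightarrow> 'a set" where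
  "pointwise_stabilizer G \<phi> A = {g \<in> carrier G. \<forall>x \<in> A. \<phi> g x = x}"

definition closed_stabilizer_action ::
    "('a, 'b) monoid_scheme \<Rightarrow> 'a topology \<Rightarrow> 'x set \<Rightarrow> ('a \<Rightarrow> 'x \<Rightarrow> 'x) \<Rightarrow> bool" where
  "closed_stabilizer_action G T E \<phi> \<longleftrightarrow>
     group_action G E \<phi> \<and> (\<forall>x \<in> E. closedin T (stabilizer G \<phi> x))"

text \<open>
  In the \<open>G\<close>-set \<open>E\<close> with action \<open>\<phi>\<close>, the set \<open>A\<close> is independent from \<open>B\<close> over \<open>C\<close>. An element
  is represented by its singleton and a tuple by its set of entries: only pointwise stabilizers
  enter. The relation is false when the data do not form a \<open>G\<close>-set with closed stabilizers.
\<close>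

definition induced_independence ::
    "('a, 'b) monoid_scheme \<Rightarrow> 'a topology \<Rightarrow> ('a set \<Rightarrow> 'a set set) \<Rightarrow>
     'x set \<Rightarrow> ('a \<Rightarrow> 'x \<Rightarrow> 'x) \<Rightarrow> 'x set \<Rightarrow> 'x set \<Rightarrow> 'x set \<Rightarrow> bool" where
  "induced_independence G T I E \<phi> A B C \<longleftrightarrow>
     closed_stabilizer_action G T E \<phi> \<and> A \<subseteq> E \<and> B \<subseteq> E \<and> C \<subseteq> E \<and>
     pointwise_stabilizer G \<phi> (C \<union> A) <#>\<^bsub>G\<^esub> pointwise_stabilizer G \<phi> (C \<union> B)
       \<notin> I (pointwise_stabilizer G \<phi> C)"

text \<open>
  The type variable \<open>'x\<close> is the type of the points of the \<open>G\<close>-sets.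
\<close>

definition strongly_admissible_geometry ::
    "('a, 'b) monoid_scheme \<Rightarrow> 'a topology \<Rightarrow>
     ('x set \<Rightarrow> ('a \<Rightarrow> 'x \<Rightarrow> 'x) \<Rightarrow> 'x set \<Rightarrow> 'x set \<Rightarrow> 'x set \<Rightarrow> bool) \<Rightarrow> bool" where
  "strongly_admissible_geometry G T R \<longleftrightarrow>
     (\<exists>I. strongly_admissible G T I \<and> R = induced_independence G T I)"

end

theory Submission
  imports Defs
begin

text \<open>
  Transitivity, invariance, and even the fact that the Haar null sets are determined by the group,
  rest on one principle in the spirit of Fubini, \<open>null_product_slices\<close>: for a closed
  subset \<open>Z\<close> of a product of two compact sets, if the slices of \<open>Z\<close> in one direction are all null,
  then the slices in the other direction cannot all have measure at least \<open>c > 0\<close> over a set of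
  positive measure. A direct appeal to the Fubini theorem for product measures is not possible,
  because without second countability a closed subset of the product need not belong to the product
  \<open>\<sigma>\<close>-algebra. Compactness replaces it: by the tube lemma, \<open>Z\<close> is covered by finitely many rectangles
  whose second sides have measure at most \<open>\<epsilon>\<close> and whose first sides partition the first compact set,
  and for such a union of rectangles both iterated integrals are finite sums.

  The principle is applied throughout to sets \<open>{(x, k). x\<^sup>-\<^sup>1 k \<in> C}\<close>, where \<open>C\<close> is compact, \<open>x\<close> ranges
  over \<open>G\<close> and \<open>k\<close> over a closed subgroup \<open>K\<close>. The slices are pieces of \<open>x C \<inter> K\<close> and of \<open>k C\<^sup>-\<^sup>1\<close>.

  \<^item> With \<open>K = G\<close> it shows that \<open>C\<close> null for one left Haar measure implies \<open>C\<^sup>-\<^sup>1\<close> null for any other.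
    Doing this twice, all left Haar measures have the same compact null sets. In a \<open>\<sigma>\<close>-compact
    group every nonnull Borel set contains a nonnull compact set, so all left Haar measures
    have the same null sets. Hence every homeomorphism that carries left translates to left
    translates preserves the null ideals; right translations and conjugations are of
    this kind, which gives invariance.

  \<^item> For transitivity let \<open>P \<le> K\<close> and \<open>H\<close> be closed subgroups of \<open>G\<close>. For \<open>x\<^sup>-\<^sup>1 \<in> H k\<close> with \<open>k\<close> in \<open>K\<close>, the set
    \<open>x H P \<inter> K\<close> is the left translate by \<open>k\<^sup>-\<^sup>1\<close> of \<open>(H \<inter> K) P\<close>, and for all other \<open>x\<close> it is empty. So \<open>H P\<close> is null
    exactly when \<open>(H \<inter> K) P\<close> is null in \<open>K\<close> or the set \<open>H K\<close> of relevant \<open>x\<^sup>-\<^sup>1\<close> is null. All three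
    products are countable unions of compact sets, which is what makes the principle applicable.

  The dichotomy is a counting argument: if \<open>K\<close> is not null it contains a compact \<open>C\<close> of positive
  measure, and only finitely many disjoint translates of \<open>C\<close> by elements of a compact set \<open>Q\<close> fit into the
  set \<open>Q C\<close> of finite measure; if countably many cosets of a null \<open>K\<close> covered the group, the whole
  group would be null.

  Since the Haar measure is introduced by a choice, all of this needs the existence of a left
  Haar measure. It is constructed from covering numbers: the ratios \<open>(A : V) / (L : V)\<close> for a fixed compact
  \<open>L\<close> accumulate, as the neighbourhood \<open>V\<close> of the identity shrinks, at a left invariant content on compact sets
  (\<open>invariant_content_exists\<close>), and every content extends to a Radon measure by Caratheodory's theorem.
\<close>

section \<open>Borel sets of a topological space\<close>

lemma space_of_borel_sets:
  assumes "sets M = sets (sigma (topspace T) {U. openin T U})"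
  shows "space M = topspace T"
  using sets_eq_imp_space_eq[OF assms] by (simp add: space_measure_of_conv)

lemma open_in_borel_sets:
  assumes "sets M = sets (sigma (topspace T) {U. openin T U})" "openin T U"
  shows "U \<in> sets M"
proof -
  have "{U. openin T U} \<subseteq> Pow (topspace T)" by (auto dest: openin_subset)
  then show ?thesis using assms by (simp add: sets_measure_of sigma_sets.Basic)
qed

lemma closed_in_borel_sets:
  assumes "sets M = sets (sigma (topspace T) {U. openin T U})" "closedin T C"
  shows "C \<in> sets M"
proof -
  have "topspace T - (topspace T - C) \<in> sets M"
    using assms by (intro sets.Diff open_in_borel_sets[OF assms(1)]) auto
  then show ?thesis using closedin_subset[OF assms(2)] by (simp add: double_diff)
qed

lemma continuous_map_measurable:
  assumes f: "continuous_map T T' f"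
    and M: "sets M = sets (sigma (topspace T) {U. openin T U})"
    and M': "sets M' = sets (sigma (topspace T') {U. openin T' U})"
  shows "f \<in> measurable M M'"
proof -
  have sub: "{U. openin T'' U} \<subseteq> Pow (topspace T'')" for T'' by (auto dest: openin_subset)
  have "f \<in> measurable M (sigma (topspace T') {U. openin T' U})"
  proof (rule measurable_measure_of[OF sub])
    show "f \<in> space M \<rightarrow> topspace T'"
      using f space_of_borel_sets[OF M] by (auto simp: continuous_map_def)
    fix U assume "U \<in> {U. openin T' U}"
    then have "openin T {x \<in> topspace T. f x \<in> U}"
      using openin_continuous_map_preimage[OF f] by simp
    then have "{x \<in> topspace T. f x \<in> U} \<in> sets M"
      unfolding M by (simp add: sets_measure_of[OF sub] sigma_sets.Basic)
    moreover have "f -` U \<inter> space M = {x \<in> topspace T. f x \<in> U}"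
      using space_of_borel_sets[OF M] by auto
    ultimately show "f -` U \<inter> space M \<in> sets M" by simp
  qed
  then show ?thesis using measurable_cong_sets[OF refl M'] by blast
qed

lemma homeomorphic_image_borel:
  assumes f: "homeomorphic_map T T' f"
    and M: "sets M = sets (sigma (topspace T) {U. openin T U})"
    and M': "sets M' = sets (sigma (topspace T') {U. openin T' U})"
    and B: "B \<in> sets M"
  shows "f ` B \<in> sets M'"
proof -
  obtain g where g: "homeomorphic_maps T T' f g"
    using f homeomorphic_map_maps by blast
  then have "g \<in> measurable M' M"
    by (intro continuous_map_measurable[OF _ M' M]) (auto simp: homeomorphic_maps_def)
  then have *: "g -` B \<inter> space M' \<in> sets M'" using B by (rule measurable_sets)
  have "B \<subseteq> topspace T"
    using sets.sets_into_space[OF B] space_of_borel_sets[OF M] by simp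
  have "g -` B \<inter> space M' = f ` B"
  proof (intro equalityI subsetI)
    fix y assume "y \<in> g -` B \<inter> space M'"
    then have "g y \<in> B" "f (g y) = y"
      using g space_of_borel_sets[OF M'] by (auto simp: homeomorphic_maps_def)
    then show "y \<in> f ` B" by force
  next
    fix y assume "y \<in> f ` B"
    then obtain x where "x \<in> B" "y = f x" by blast
    then show "y \<in> g -` B \<inter> space M'"
      using g \<open>B \<subseteq> topspace T\<close> space_of_borel_sets[OF M'] homeomorphic_imp_surjective_map[OF f]
      by (auto simp: homeomorphic_maps_def)
  qed
  with * show ?thesis by simp
qed

section \<open>From a content on compact sets to a Radon measure\<close>

text \<open>
  A content on the compact sets is enough to obtain a Radon measure: the regularity conditions
  dictate its value first on open sets and then on all sets.
\<close>

locale compact_content =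
  fixes T :: "'a topology" and l :: "'a set \<Rightarrow> real"
  assumes Hausdorff: "Hausdorff_space T"
    and locally_compact: "locally_compact_space T"
    and content_nonneg: "compactin T A \<Longrightarrow> 0 \<le> l A"
    and content_mono: "compactin T A \<Longrightarrow> compactin T B \<Longrightarrow> A \<subseteq> B \<Longrightarrow> l A \<le> l B"
    and content_subadd: "compactin T A \<Longrightarrow> compactin T B \<Longrightarrow> l (A \<union> B) \<le> l A + l B"
    and content_superadd: "compactin T A \<Longrightarrow> compactin T B \<Longrightarrow> A \<inter> B = {} \<Longrightarrow> l A + l B \<le> l (A \<union> B)"
begin

text \<open>
  Meant for open sets, where inner regularity forces this value.
\<close>

definition inner_content :: "'a set \<Rightarrow> ennreal" where
  "inner_content U = (SUP C \<in> {C. compactin T C \<and> C \<subseteq> U}. ennreal (l C))"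

text \<open>
  Forced by outer regularity; an outer measure in the sense of Caratheodory.
\<close>

definition outer_content :: "'a set \<Rightarrow> ennreal" where
  "outer_content E = (INF U \<in> {U. openin T U \<and> E \<subseteq> U}. inner_content U)"

lemma content_empty: "l {} = 0"
  using content_superadd[of "{}" "{}"] content_nonneg[of "{}"] by simp

lemma inner_content_mono: "U \<subseteq> V \<Longrightarrow> inner_content U \<le> inner_content V"
  unfolding inner_content_def by (rule SUP_subset_mono) auto

lemma content_le_inner: "compactin T C \<Longrightarrow> C \<subseteq> U \<Longrightarrow> ennreal (l C) \<le> inner_content U"
  unfolding inner_content_def by (rule SUP_upper) auto

lemma outer_content_open: "openin T U \<Longrightarrow> outer_content U = inner_content U"
  unfolding outer_content_def
  by (intro antisym INF_lower INF_greatest) (auto intro: inner_content_mono)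

lemma outer_content_mono: "E \<subseteq> F \<Longrightarrow> outer_content E \<le> outer_content F"
  unfolding outer_content_def by (rule INF_superset_mono) auto

lemma content_le_outer: "compactin T C \<Longrightarrow> ennreal (l C) \<le> outer_content C"
  unfolding outer_content_def by (intro INF_greatest content_le_inner) auto

lemma inner_content_empty: "inner_content {} = 0"
proof -
  have "{C. compactin T C \<and> C \<subseteq> {}} = {{}}" by auto
  then show ?thesis by (simp add: inner_content_def content_empty)
qed

text \<open>
  Local compactness places \<open>C\<close> inside an open set that lies in a compact set \<open>L\<close>, and the content of
  \<open>L\<close> bounds everything in between.
\<close>

lemma outer_content_compact_finite:
  assumes "compactin T C" shows "outer_content C < \<infinity>"
proof -
  obtain U L where UL: "openin T U" "compactin T L" "C \<subseteq> U" "U \<subseteq> L"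
    using locally_compact_space_compact_closed_compact[of T] Hausdorff locally_compact assms
    by metis
  have "outer_content C \<le> inner_content U"
    unfolding outer_content_def using UL by (intro INF_lower) auto
  also have "\<dots> \<le> ennreal (l L)"
    unfolding inner_content_def using UL by (intro SUP_least ennreal_leI content_mono) auto
  finally show ?thesis by (simp add: le_less_trans)
qed

text \<open>
  The compact sets \<open>C - U\<close> and \<open>C - V\<close> are disjoint, hence have disjoint open neighbourhoods; removing
  each of these from \<open>C\<close> leaves the two pieces. This turns additivity of the content on compact sets
  into subadditivity on open sets.
\<close>

lemma compact_split:
  assumes C: "compactin T C" and U: "openin T U" and V: "openin T V" and "C \<subseteq> U \<union> V"
  obtains C1 C2 where "compactin T C1" "compactin T C2" "C = C1 \<union> C2" "C1 \<subseteq> U" "C2 \<subseteq> V"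
proof -
  have diff: "compactin T (C - W)" if "openin T W" for W
  proof -
    have "C - W = C \<inter> (topspace T - W)" using compactin_subset_topspace[OF C] by auto
    then show ?thesis using compact_Int_closedin[OF C] that by (metis closedin_diff closedin_topspace)
  qed
  have "disjnt (C - U) (C - V)" using assms(4) by (auto simp: disjnt_def)
  then obtain U' V' where *: "openin T U'" "openin T V'" "C - U \<subseteq> U'" "C - V \<subseteq> V'" "disjnt U' V'"
    using Hausdorff_space_compact_separation[OF Hausdorff diff[OF U] diff[OF V]] by metis
  show thesis
    by (rule that[of "C - U'" "C - V'"]) (use * diff in \<open>auto simp: disjnt_def\<close>)
qed

lemma inner_content_Un:
  assumes "openin T U" "openin T V"
  shows "inner_content (U \<union> V) \<le> inner_content U + inner_content V"
  unfolding inner_content_def[of "U \<union> V"]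
proof (rule SUP_least, clarsimp)
  fix C assume C: "compactin T C" "C \<subseteq> U \<union> V"
  obtain C1 C2 where *: "compactin T C1" "compactin T C2" "C = C1 \<union> C2" "C1 \<subseteq> U" "C2 \<subseteq> V"
    using compact_split[OF C(1) assms C(2)] by blast
  have "ennreal (l C) \<le> ennreal (l C1 + l C2)"
    using * by (auto intro: ennreal_leI content_subadd)
  also have "\<dots> = ennreal (l C1) + ennreal (l C2)"
    using * by (simp add: content_nonneg)
  also have "\<dots> \<le> inner_content U + inner_content V"
    using * by (intro add_mono content_le_inner)
  finally show "ennreal (l C) \<le> inner_content U + inner_content V" .
qed

lemma inner_content_UN_finite:
  fixes U :: "nat \<Rightarrow> 'a set"
  assumes "\<And>i. openin T (U i)"
  shows "inner_content (\<Union>i<n. U i) \<le> (\<Sum>i<n. inner_content (U i))"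
proof (induction n)
  case 0 then show ?case by (simp add: inner_content_empty)
next
  case (Suc n)
  have "inner_content (\<Union>i<Suc n. U i) = inner_content ((\<Union>i<n. U i) \<union> U n)"
    by (simp add: lessThan_Suc Un_commute)
  also have "\<dots> \<le> inner_content (\<Union>i<n. U i) + inner_content (U n)"
    by (rule inner_content_Un) (use assms in auto)
  also have "\<dots> \<le> (\<Sum>i<Suc n. inner_content (U i))"
    using Suc by (simp add: add_right_mono)
  finally show ?case .
qed

lemma inner_content_UN:
  fixes U :: "nat \<Rightarrow> 'a set"
  assumes U: "\<And>i. openin T (U i)"
  shows "inner_content (\<Union>i. U i) \<le> (\<Sum>i. inner_content (U i))"
  unfolding inner_content_def[of "\<Union>i. U i"]
proof (rule SUP_least, clarsimp)
  fix C assume C: "compactin T C" "C \<subseteq> (\<Union>i. U i)"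
  then obtain F where F: "finite F" "F \<subseteq> range U" "C \<subseteq> \<Union>F"
    unfolding compactin_def using U by (metis (no_types, lifting) rangeE)
  then obtain I where I: "finite I" "F = U ` I"
    by (metis finite_subset_image)
  then obtain n where n: "I \<subseteq> {..<n}"
    by (meson finite_nat_iff_bounded)
  have "ennreal (l C) \<le> inner_content (\<Union>i<n. U i)"
    using C F I n by (intro content_le_inner) blast+
  also have "\<dots> \<le> (\<Sum>i<n. inner_content (U i))"
    by (rule inner_content_UN_finite[OF U])
  also have "\<dots> \<le> (\<Sum>i. inner_content (U i))"
    by (intro sum_le_suminf) auto
  finally show "ennreal (l C) \<le> (\<Sum>i. inner_content (U i))" .
qed

lemma outer_content_countably_subadditive:
  "countably_subadditive (Pow (topspace T)) outer_content"
  unfolding countably_subadditive_def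
proof (intro allI impI)
  fix A :: "nat \<Rightarrow> 'a set"
  show "outer_content (\<Union>i. A i) \<le> (\<Sum>n. outer_content (A n))"
  proof (rule ennreal_le_epsilon)
    fix e :: real assume "0 < e" "(\<Sum>n. outer_content (A n)) < Orderings.top"
    then have *: "\<And>n. outer_content (A n) < outer_content (A n) + e * (1/2)^Suc n"
      by (auto simp add: less_top dest!: ennreal_suminf_lessD)
    have "\<exists>U. openin T U \<and> A n \<subseteq> U \<and> inner_content U \<le> outer_content (A n) + e * (1/2)^Suc n" for n
      using *[of n] unfolding outer_content_def INF_less_iff by (auto intro: less_imp_le)
    then obtain U where U: "\<And>n. openin T (U n)" "\<And>n. A n \<subseteq> U n"
      "\<And>n. inner_content (U n) \<le> outer_content (A n) + e * (1/2)^Suc n" by metis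
    have "outer_content (\<Union>i. A i) \<le> outer_content (\<Union>i. U i)"
      by (rule outer_content_mono) (use U in blast)
    also have "\<dots> = inner_content (\<Union>i. U i)"
      by (rule outer_content_open) (use U in auto)
    also have "\<dots> \<le> (\<Sum>i. inner_content (U i))"
      by (rule inner_content_UN[OF U(1)])
    also have "\<dots> \<le> (\<Sum>n. outer_content (A n) + e * (1/2) ^ Suc n)"
      by (intro suminf_le U(3)) auto
    also have "... = (\<Sum>n. outer_content (A n)) + (\<Sum>n. ennreal e * ennreal ((1/2) ^ Suc n))"
      using \<open>0 < e\<close> by (subst suminf_add[symmetric])
                       (auto simp del: ennreal_suminf_cmult simp add: ennreal_mult[symmetric])
    also have "\<dots> = (\<Sum>n. outer_content (A n)) + e"
      unfolding ennreal_suminf_cmult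
      by (subst suminf_ennreal_eq[OF zero_le_power power_half_series]) auto
    finally show "outer_content (\<Union>i. A i) \<le> (\<Sum>n. outer_content (A n)) + e" .
  qed
qed

lemma outer_measure_space_outer_content:
  "outer_measure_space (Pow (topspace T)) outer_content"
  unfolding outer_measure_space_def positive_def increasing_def
  using outer_content_countably_subadditive outer_content_open[of "{}"] inner_content_empty
  by (auto intro: outer_content_mono)

text \<open>
  This is where additivity on disjoint compact sets enters: approximate \<open>V \<inter> U\<close> from inside by a
  compact \<open>C\<close>, and then the open set \<open>V - C\<close>, which contains \<open>V - U\<close>, by a compact \<open>D\<close> disjoint from \<open>C\<close>.
\<close>

lemma inner_content_superadd:
  assumes U: "openin T U" and V: "openin T V"
  shows "inner_content (V \<inter> U) + outer_content (V - U) \<le> inner_content V"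
proof -
  have 1: "ennreal (l C) + outer_content (V - U) \<le> inner_content V"
    if C: "compactin T C" "C \<subseteq> V \<inter> U" for C
  proof -
    have op: "openin T (V - C)"
      using V compactin_imp_closedin[OF Hausdorff C(1)] by (rule openin_diff)
    have 2: "ennreal (l C) + ennreal (l D) \<le> inner_content V"
      if D: "compactin T D" "D \<subseteq> V - C" for D
    proof -
      have "ennreal (l C) + ennreal (l D) = ennreal (l C + l D)"
        using C D by (simp add: content_nonneg)
      also have "\<dots> \<le> ennreal (l (C \<union> D))"
        using C D by (intro ennreal_leI content_superadd) auto
      also have "\<dots> \<le> inner_content V"
        using C D by (intro content_le_inner compactin_Un) auto
      finally show ?thesis .
    qed
    have "ennreal (l C) + outer_content (V - U) \<le> ennreal (l C) + outer_content (V - C)"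
      using C by (intro add_left_mono outer_content_mono) auto
    also have "\<dots> = ennreal (l C) + inner_content (V - C)"
      by (simp add: outer_content_open[OF op])
    also have "\<dots> = (SUP D\<in>{D. compactin T D \<and> D \<subseteq> V - C}. ennreal (l C) + ennreal (l D))"
      unfolding inner_content_def[of "V - C"]
      by (subst ennreal_SUP_add_right) auto
    also have "\<dots> \<le> inner_content V"
      by (rule SUP_least) (use 2 in auto)
    finally show ?thesis .
  qed
  have "inner_content (V \<inter> U) + outer_content (V - U)
      = (SUP C\<in>{C. compactin T C \<and> C \<subseteq> V \<inter> U}. ennreal (l C) + outer_content (V - U))"
    unfolding inner_content_def[of "V \<inter> U"]
    by (subst ennreal_SUP_add_left) auto
  also have "\<dots> \<le> inner_content V"
    by (rule SUP_least) (use 1 in auto)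
  finally show ?thesis .
qed

text \<open>
  The Caratheodory condition for open \<open>U\<close> need only be tested against open sets, as the outer measure
  of an arbitrary set is an infimum over them.
\<close>

lemma open_in_lambda_system:
  assumes U: "openin T U"
  shows "U \<in> lambda_system (topspace T) (Pow (topspace T)) outer_content"
proof -
  interpret sigma_algebra "topspace T" "Pow (topspace T)" by (rule sigma_algebra_Pow)
  have oms: "positive (Pow (topspace T)) outer_content" "subadditive (Pow (topspace T)) outer_content"
    using outer_measure_space_outer_content countably_subadditive_subadditive
    by (auto simp: outer_measure_space_def)
  have "outer_content (E \<inter> U) + outer_content (E - U) = outer_content E" if E: "E \<subseteq> topspace T" for E
  proof (rule antisym)
    have "outer_content (E \<inter> U) + outer_content (E - U) \<le> inner_content V"
      if V: "openin T V" "E \<subseteq> V" for V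
    proof -
      have "outer_content (E \<inter> U) \<le> inner_content (V \<inter> U)"
        unfolding outer_content_def using U V by (intro INF_lower) auto
      moreover have "outer_content (E - U) \<le> outer_content (V - U)"
        using V by (intro outer_content_mono) auto
      ultimately show ?thesis
        using inner_content_superadd[OF U V(1)] by (meson add_mono order_trans)
    qed
    then show "outer_content (E \<inter> U) + outer_content (E - U) \<le> outer_content E"
      unfolding outer_content_def[of E] by (intro INF_greatest) auto
    have "outer_content ((E \<inter> U) \<union> (E - U)) \<le> outer_content (E \<inter> U) + outer_content (E - U)"
      using oms(2) E by (intro subadditiveD[of "Pow (topspace T)"]) auto
    then show "outer_content E \<le> outer_content (E \<inter> U) + outer_content (E - U)"
      by (simp add: Un_Diff_Int Int_Un_eq Un_commute)
  qed
  then show ?thesis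
    using openin_subset[OF U] by (auto simp: lambda_system_eq)
qed

definition content_measure :: "'a measure" where
  "content_measure = measure_of (topspace T) {U. openin T U} outer_content"

lemma open_subset_Pow: "{U. openin T U} \<subseteq> Pow (topspace T)"
  by (auto dest: openin_subset)

lemma sets_content_measure: "sets content_measure = sets (sigma (topspace T) {U. openin T U})"
  unfolding content_measure_def using open_subset_Pow by (simp add: sets_measure_of)

lemma emeasure_content_measure:
  assumes "B \<in> sets content_measure"
  shows "emeasure content_measure B = outer_content B"
proof -
  interpret sigma_algebra "topspace T" "Pow (topspace T)" by (rule sigma_algebra_Pow)
  let ?L = "lambda_system (topspace T) (Pow (topspace T)) outer_content"
  have L: "measure_space (topspace T) ?L outer_content"
    using caratheodory_lemma[OF outer_measure_space_outer_content] .
  then have "sigma_sets (topspace T) {U. openin T U} \<subseteq> ?L"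
    using open_in_lambda_system
    by (intro sigma_algebra.sigma_sets_subset) (auto simp: measure_space_def)
  then have "measure_space (topspace T) (sigma_sets (topspace T) {U. openin T U}) outer_content"
    using measure_down[OF L] sigma_algebra_sigma_sets[OF open_subset_Pow] by blast
  moreover have "sets content_measure = sigma_sets (topspace T) {U. openin T U}"
    unfolding content_measure_def using open_subset_Pow by (simp add: sets_measure_of)
  ultimately show ?thesis
    using assms open_subset_Pow
    by (intro emeasure_measure_of[OF content_measure_def]) (auto simp: measure_space_def)
qed

lemma open_sets_content_measure: "openin T U \<Longrightarrow> U \<in> sets content_measure"
  using open_subset_Pow unfolding sets_content_measure by (auto simp: sets_measure_of)

lemma compact_sets_content_measure: 
  assumes "compactin T C" shows "C \<in> sets content_measure"
proof -
  have "openin T (topspace T - C)"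
    using compactin_imp_closedin[OF Hausdorff assms] by blast
  then have "topspace T - (topspace T - C) \<in> sets content_measure"
    using open_sets_content_measure[of "topspace T"] open_sets_content_measure by blast
  then show ?thesis using compactin_subset_topspace[OF assms] by (simp add: double_diff)
qed

text \<open>
  The measure of a compact set may exceed its content. The inequality yields inner regularity on
  open sets and shows that the measure is not zero.
\<close>

lemma content_le_content_measure:
  "compactin T C \<Longrightarrow> ennreal (l C) \<le> emeasure content_measure C"
  by (simp add: emeasure_content_measure compact_sets_content_measure content_le_outer)

lemma content_measure_compact_finite: "compactin T C \<Longrightarrow> emeasure content_measure C < \<infinity>"
  using outer_content_compact_finite
  by (simp add: emeasure_content_measure compact_sets_content_measure)

lemma content_measure_outer_regular:
  assumes "B \<in> sets content_measure"
  shows "emeasure content_measure B = (INF U \<in> {U. openin T U \<and> B \<subseteq> U}. emeasure content_measure U)"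
  using assms
  by (simp add: emeasure_content_measure outer_content_def[of B] open_sets_content_measure
      outer_content_open cong: INF_cong_simp)

lemma content_measure_inner_regular:
  assumes U: "openin T U"
  shows "emeasure content_measure U = (SUP K \<in> {K. compactin T K \<and> K \<subseteq> U}. emeasure content_measure K)"
proof (rule antisym)
  have "emeasure content_measure U = inner_content U"
    using U by (simp add: emeasure_content_measure open_sets_content_measure outer_content_open)
  also have "\<dots> \<le> (SUP K \<in> {K. compactin T K \<and> K \<subseteq> U}. emeasure content_measure K)"
    unfolding inner_content_def by (rule SUP_mono) (auto intro: content_le_content_measure)
  finally show "emeasure content_measure U \<le> \<dots>" .
  show "(SUP K \<in> {K. compactin T K \<and> K \<subseteq> U}. emeasure content_measure K) \<le> emeasure content_measure U"
    using U by (intro SUP_least emeasure_mono) (auto intro: open_sets_content_measure)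
qed

end

section \<open>Covering numbers in a topological group\<close>

locale locally_compact_group = topological_group G T for G (structure) and T +
  assumes Hausdorff: "Hausdorff_space T" and locally_compact: "locally_compact_space T"

context topological_group
begin

lemma lcos_eq_image: "g <# X = (\<lambda>x. g \<otimes> x) ` X"
  by (auto simp: l_coset_def)

lemma continuous_map_group_mult:
  "continuous_map X T f \<Longrightarrow> continuous_map X T g \<Longrightarrow> continuous_map X T (\<lambda>x. f x \<otimes> g x)"
  using continuous_map_compose[OF continuous_map_pairedI continuous_mult, of X f g]
  by (simp add: o_def)

lemma continuous_map_group_inv:
  "continuous_map X T f \<Longrightarrow> continuous_map X T (\<lambda>x. inv (f x))"
  using continuous_map_compose[OF _ continuous_inv, of X f] by (simp add: o_def)

lemma continuous_map_group_const: "g \<in> carrier G \<Longrightarrow> continuous_map X T (\<lambda>x. g)"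
  by (simp add: topspace_eq)

lemma homeomorphic_map_left_mult:
  assumes "g \<in> carrier G" shows "homeomorphic_map T T (\<lambda>x. g \<otimes> x)"
proof -
  have "homeomorphic_maps T T (\<lambda>x. g \<otimes> x) (\<lambda>x. inv g \<otimes> x)"
    unfolding homeomorphic_maps_def using assms
    by (auto simp: topspace_eq m_assoc[symmetric]
        intro!: continuous_map_group_mult continuous_map_group_const continuous_map_id[unfolded id_def])
  then show ?thesis using homeomorphic_maps_map by blast
qed

lemma openin_lcos: "g \<in> carrier G \<Longrightarrow> openin T U \<Longrightarrow> openin T (g <# U)"
  unfolding lcos_eq_image using homeomorphic_map_left_mult homeomorphic_map_openness_eq by blast

lemma compactin_lcos: "g \<in> carrier G \<Longrightarrow> compactin T K \<Longrightarrow> compactin T (g <# K)"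
  unfolding lcos_eq_image using homeomorphic_map_left_mult homeomorphic_map_compactness_eq by blast

lemma set_mult_eq_image: "H <#> K = (\<lambda>(x, y). x \<otimes> y) ` (H \<times> K)"
  by (auto simp: set_mult_def)

lemma compactin_set_mult: "compactin T H \<Longrightarrow> compactin T K \<Longrightarrow> compactin T (H <#> K)"
  unfolding set_mult_eq_image
  by (rule image_compactin[OF _ continuous_mult]) (simp add: compactin_Times)

lemma compactin_inv_image: "compactin T K \<Longrightarrow> compactin T ((\<lambda>x. inv x) ` K)"
  by (rule image_compactin[OF _ continuous_inv])

lemma inv_lcos_lcos: "g \<in> carrier G \<Longrightarrow> X \<subseteq> carrier G \<Longrightarrow> inv g <# (g <# X) = X"
  by (simp add: lcos_m_assoc lcos_mult_one)

definition covers :: "'a set \<Rightarrow> 'a set \<Rightarrow> 'a set \<Rightarrow> bool" where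
  "covers F A V \<longleftrightarrow> finite F \<and> F \<subseteq> carrier G \<and> A \<subseteq> (\<Union>g\<in>F. g <# V)"

text \<open>
  The classical index \<open>(A : V)\<close>. The least element is meaningful when \<open>A\<close> is compact and \<open>V\<close> is an open
  neighbourhood of the identity.
\<close>

definition covering_number :: "'a set \<Rightarrow> 'a set \<Rightarrow> nat" where
  "covering_number A V = (LEAST n. \<exists>F. covers F A V \<and> card F = n)"

lemma covering_number_le: "covers F A V \<Longrightarrow> covering_number A V \<le> card F"
  unfolding covering_number_def by (rule Least_le) auto

lemma covering_number_attained:
  assumes A: "compactin T A" and V: "openin T V" "\<one> \<in> V"
  obtains F where "covers F A V" "card F = covering_number A V"
proof -
  have sub: "A \<subseteq> carrier G" using compactin_subset_topspace[OF A] topspace_eq by simp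
  have "\<forall>U\<in>(\<lambda>g. g <# V) ` A. openin T U" using sub V by (auto intro: openin_lcos)
  moreover have "A \<subseteq> \<Union>((\<lambda>g. g <# V) ` A)"
  proof
    fix a assume "a \<in> A"
    then have "a \<in> a <# V" using sub V(2) r_one[of a] unfolding lcos_eq_image by force
    with \<open>a \<in> A\<close> show "a \<in> \<Union>((\<lambda>g. g <# V) ` A)" by blast
  qed
  ultimately obtain \<F> where "finite \<F>" "\<F> \<subseteq> (\<lambda>g. g <# V) ` A" "A \<subseteq> \<Union>\<F>"
    using A unfolding compactin_def by meson
  then obtain F where F: "finite F" "F \<subseteq> A" "A \<subseteq> \<Union>((\<lambda>g. g <# V) ` F)"
    by (metis finite_subset_image)
  then have "\<exists>F'. covers F' A V \<and> card F' = card F"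
    using sub unfolding covers_def by blast
  then have "\<exists>F. covers F A V \<and> card F = covering_number A V"
    unfolding covering_number_def by (rule LeastI)
  then show thesis using that by blast
qed

lemma covering_number_mono:
  assumes "compactin T B" "openin T V" "\<one> \<in> V" "A \<subseteq> B"
  shows "covering_number A V \<le> covering_number B V"
proof -
  obtain F where "covers F B V" "card F = covering_number B V"
    using covering_number_attained assms by blast
  then show ?thesis using covering_number_le[of F A V] assms by (auto simp: covers_def)
qed

lemma covering_number_Un:
  assumes "compactin T A" "compactin T B" "openin T V" "\<one> \<in> V"
  shows "covering_number (A \<union> B) V \<le> covering_number A V + covering_number B V"
proof -
  obtain F where F: "covers F A V" "card F = covering_number A V"
    using covering_number_attained assms by blast
  obtain E where E: "covers E B V" "card E = covering_number B V"
    using covering_number_attained assms by blast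
  have "covers (F \<union> E) (A \<union> B) V" using F E by (auto simp: covers_def)
  then show ?thesis using covering_number_le card_Un_le[of F E] F E by (metis order_trans)
qed

lemma covering_number_lcos_le:
  assumes "compactin T A" "openin T V" "\<one> \<in> V" "g \<in> carrier G"
  shows "covering_number (g <# A) V \<le> covering_number A V"
proof -
  obtain F where F: "covers F A V" "card F = covering_number A V"
    using covering_number_attained assms by blast
  have V: "V \<subseteq> carrier G" using openin_subset[OF assms(2)] topspace_eq by simp
  have "covers ((\<lambda>x. g \<otimes> x) ` F) (g <# A) V"
    unfolding covers_def
  proof (intro conjI)
    show "g <# A \<subseteq> (\<Union>f\<in>(\<lambda>x. g \<otimes> x) ` F. f <# V)"
    proof
      fix y assume "y \<in> g <# A"
      then obtain a where a: "a \<in> A" "y = g \<otimes> a" by (auto simp: lcos_eq_image)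
      then obtain f v where "f \<in> F" "v \<in> V" "a = f \<otimes> v"
        using F(1) by (fastforce simp: covers_def lcos_eq_image)
      show "y \<in> (\<Union>f\<in>(\<lambda>x. g \<otimes> x) ` F. f <# V)"
      proof -
        have "y = (g \<otimes> f) \<otimes> v"
          using a F(1) V assms(4) \<open>f \<in> F\<close> \<open>v \<in> V\<close> \<open>a = f \<otimes> v\<close> by (simp add: covers_def m_assoc subset_iff)
        then show ?thesis using \<open>f \<in> F\<close> \<open>v \<in> V\<close> unfolding lcos_eq_image by blast
      qed
    qed
  qed (use F assms(4) in \<open>auto simp: covers_def\<close>)
  from covering_number_le[OF this] show ?thesis
    using card_image_le[of F "\<lambda>x. g \<otimes> x"] F unfolding covers_def by linarith
qed

lemma covering_number_lcos:
  assumes "compactin T A" "openin T V" "\<one> \<in> V" "g \<in> carrier G"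
  shows "covering_number (g <# A) V = covering_number A V"
proof (rule antisym)
  show "covering_number (g <# A) V \<le> covering_number A V"
    by (rule covering_number_lcos_le[OF assms])
  have "A \<subseteq> carrier G" using compactin_subset_topspace[OF assms(1)] topspace_eq by simp
  then show "covering_number A V \<le> covering_number (g <# A) V"
    using covering_number_lcos_le[OF compactin_lcos[OF assms(4,1)] assms(2,3), of "inv g"] assms(4)
    by (simp add: inv_lcos_lcos)
qed

text \<open>
  The inequality \<open>(A : V) \<le> (A : W) (K : V)\<close>. It bounds the ratios \<open>(A : V) / (K : V)\<close> independently of \<open>V\<close>,
  which makes the passage to a limit possible.
\<close>

lemma covering_number_trans:
  assumes A: "compactin T A" and W: "openin T W" "\<one> \<in> W" "W \<subseteq> K" and K: "compactin T K"
    and V: "openin T V" "\<one> \<in> V"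
  shows "covering_number A V \<le> covering_number A W * covering_number K V"
proof -
  obtain F where F: "covers F A W" "card F = covering_number A W"
    using covering_number_attained A W by blast
  obtain E where E: "covers E K V" "card E = covering_number K V"
    using covering_number_attained K V by blast
  have VG: "V \<subseteq> carrier G" using openin_subset[OF V(1)] topspace_eq by simp
  let ?P = "(\<lambda>(f, e). f \<otimes> e) ` (F \<times> E)"
  have "A \<subseteq> (\<Union>g\<in>?P. g <# V)"
  proof
    fix a assume "a \<in> A"
    then obtain f w where fw: "f \<in> F" "w \<in> W" "a = f \<otimes> w"
      using F(1) by (auto simp: covers_def lcos_eq_image)
    then obtain e v where "e \<in> E" "v \<in> V" "w = e \<otimes> v"
      using E(1) W(3) by (auto simp: covers_def lcos_eq_image subset_iff)
    then have "f \<otimes> e \<in> ?P" "a = (f \<otimes> e) \<otimes> v" "v \<in> V"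
      using fw F(1) E(1) VG by (auto simp: covers_def m_assoc subset_iff)
    then show "a \<in> (\<Union>g\<in>?P. g <# V)" unfolding lcos_eq_image by blast
  qed
  then have "covers ?P A V" using F E by (auto simp: covers_def)
  moreover have "card ?P \<le> card F * card E"
    using card_image_le[of "F \<times> E"] F E by (simp add: covers_def card_cartesian_product)
  ultimately show ?thesis using covering_number_le F E by (metis order_trans)
qed

text \<open>
  If no translate of \<open>V\<close> meets both sets, the members of an optimal cover of the union that meet \<open>A\<close>
  and those that meet \<open>B\<close> form disjoint families.
\<close>

lemma covering_number_superadd:
  assumes "compactin T A" "compactin T B" "openin T V" "\<one> \<in> V"
    and sep: "\<And>g. g \<in> carrier G \<Longrightarrow> (g <# V) \<inter> A = {} \<or> (g <# V) \<inter> B = {}"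
  shows "covering_number A V + covering_number B V \<le> covering_number (A \<union> B) V"
proof -
  obtain F where F: "covers F (A \<union> B) V" "card F = covering_number (A \<union> B) V"
    using covering_number_attained[OF compactin_Un] assms by metis
  let ?FA = "{g\<in>F. (g <# V) \<inter> A \<noteq> {}}" and ?FB = "{g\<in>F. (g <# V) \<inter> B \<noteq> {}}"
  have "covers ?FA A V" using F(1) unfolding covers_def by (auto simp: subset_iff) blast
  moreover have "covers ?FB B V" using F(1) unfolding covers_def by (auto simp: subset_iff) blast
  ultimately have "covering_number A V + covering_number B V \<le> card ?FA + card ?FB"
    by (intro add_mono covering_number_le)
  also have "\<dots> = card (?FA \<union> ?FB)"
    using F(1) sep by (intro card_Un_disjoint[symmetric]) (auto simp: covers_def subset_iff)
  also have "\<dots> \<le> card F" using F(1) by (intro card_mono) (auto simp: covers_def)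
  finally show ?thesis using F by simp
qed

lemma covering_number_pos:
  assumes "compactin T A" "openin T V" "\<one> \<in> V" "A \<noteq> {}"
  shows "0 < covering_number A V"
proof -
  obtain F where "covers F A V" "card F = covering_number A V"
    using covering_number_attained assms by blast
  then show ?thesis using assms(4) by (cases "F = {}") (auto simp: covers_def card_gt_0_iff)
qed

end

section \<open>Existence of a left Haar measure\<close>

context locally_compact_group
begin

text \<open>
  If \<open>g v \<in> A\<close> and \<open>g w \<in> B\<close> then \<open>v\<^sup>-\<^sup>1 w \<in> A\<^sup>-\<^sup>1 B\<close>. The compact set \<open>A\<^sup>-\<^sup>1 B\<close> avoids the identity, so continuity
  of \<open>(v, w) \<mapsto> v\<^sup>-\<^sup>1 w\<close> excludes this for \<open>v\<close> and \<open>w\<close> near the identity. Hence covering numbers become additive on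
  disjoint compact sets for all sufficiently small neighbourhoods.
\<close>

lemma separating_neighbourhood:
  assumes A: "compactin T A" and B: "compactin T B" and disj: "A \<inter> B = {}"
  obtains V where "openin T V" "\<one> \<in> V"
    "\<And>V' g. V' \<subseteq> V \<Longrightarrow> g \<in> carrier G \<Longrightarrow> (g <# V') \<inter> A = {} \<or> (g <# V') \<inter> B = {}"
proof -
  have sub: "A \<subseteq> carrier G" "B \<subseteq> carrier G"
    using A B compactin_subset_topspace topspace_eq by auto
  let ?D = "(\<lambda>x. inv x) ` A <#> B"
  have "compactin T ?D" using A B by (intro compactin_set_mult compactin_inv_image)
  then have op: "openin T (topspace T - ?D)" using compactin_imp_closedin[OF Hausdorff] by blast
  have "\<one> \<notin> ?D"
  proof
    assume "\<one> \<in> ?D"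
    then obtain a b where "a \<in> A" "b \<in> B" "\<one> = inv a \<otimes> b" by (auto simp: set_mult_def)
    then have "a = b" using sub by (metis inv_equality inv_inv subsetD inv_closed)
    then show False using \<open>a \<in> A\<close> \<open>b \<in> B\<close> disj by auto
  qed
  have cont: "continuous_map (prod_topology T T) T (\<lambda>p. inv (fst p) \<otimes> snd p)"
    by (intro continuous_map_group_mult continuous_map_group_inv continuous_map_fst continuous_map_snd)
  define N where "N = {p \<in> topspace (prod_topology T T). inv (fst p) \<otimes> snd p \<in> topspace T - ?D}"
  have "openin (prod_topology T T) N"
    unfolding N_def using openin_continuous_map_preimage[OF cont op] .
  moreover have "(\<one>, \<one>) \<in> N" using \<open>\<one> \<notin> ?D\<close> by (simp add: N_def topspace_eq)
  ultimately obtain V1 V2 where V12: "openin T V1" "openin T V2" "\<one> \<in> V1" "\<one> \<in> V2" "V1 \<times> V2 \<subseteq> N"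
    unfolding openin_prod_topology_alt by meson
  let ?V = "V1 \<inter> V2"
  have "(g <# V') \<inter> A = {} \<or> (g <# V') \<inter> B = {}" if V': "V' \<subseteq> ?V" and g: "g \<in> carrier G" for V' g
  proof (rule ccontr)
    assume "\<not> ?thesis"
    then obtain v w where vw: "v \<in> V'" "w \<in> V'" "g \<otimes> v \<in> A" "g \<otimes> w \<in> B"
      by (auto simp: lcos_eq_image)
    have vwG: "v \<in> carrier G" "w \<in> carrier G"
      using vw V' openin_subset[OF V12(1)] topspace_eq by auto
    have "inv (g \<otimes> v) \<otimes> (g \<otimes> w) = inv v \<otimes> w"
      using vwG g by (simp add: inv_mult_group m_assoc) (simp add: m_assoc[symmetric])
    moreover have "inv (g \<otimes> v) \<otimes> (g \<otimes> w) \<in> ?D" using vw unfolding set_mult_def by blast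
    ultimately have "inv v \<otimes> w \<in> ?D" by simp
    moreover have "(v, w) \<in> N" using V12(5) vw V' by blast
    ultimately show False by (auto simp: N_def)
  qed
  then show thesis using that[of ?V] V12 by blast
qed

text \<open>
  All normalised covering numbers lie in a product of compact intervals, so by Tychonoff's theorem
  they have a point of accumulation as \<open>V\<close> shrinks to the identity. Every property asserted is a closed
  condition on finitely many coordinates that holds for the covering numbers of all small enough \<open>V\<close>, and
  therefore survives in the limit.
\<close>

theorem invariant_content_exists:
  obtains l :: "'a set \<Rightarrow> real" and K
  where "compact_content T l" "\<And>g A. g \<in> carrier G \<Longrightarrow> compactin T A \<Longrightarrow> l (g <# A) = l A"
    "compactin T K" "l K = 1"
proof -
  obtain W K where W: "openin T W" "compactin T K" "\<one> \<in> W" "W \<subseteq> K"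
    using locally_compact topspace_eq unfolding locally_compact_space_def by (metis one_closed)
  define NB where "NB = {V. openin T V \<and> \<one> \<in> V}"
  define r where "r V A = (if compactin T A then real (covering_number A V) / real (covering_number K V) else 0)" for V A
  define b where "b A = (if compactin T A then real (covering_number A W) else 0)" for A
  have Kpos: "0 < covering_number K V" if "V \<in> NB" for V
    using that W covering_number_pos[of K V] by (auto simp: NB_def)
  define Box where "Box = Pi\<^sub>E UNIV (\<lambda>A. {0..b A})"
  have "compactin (product_topology (\<lambda>i. euclidean) UNIV) Box"
    unfolding Box_def compactin_PiE by simp
  then have compact: "compact Box" by (simp add: euclidean_product_topology)
  have r_Box: "r V \<in> Box" if V: "V \<in> NB" for V
  proof -
    have "real (covering_number A V) / real (covering_number K V) \<le> real (covering_number A W)"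
      if A: "compactin T A" for A
    proof -
      have "covering_number A V \<le> covering_number A W * covering_number K V"
        using covering_number_trans[OF A W(1,3,4,2)] V by (auto simp: NB_def)
      then have "real (covering_number A V) \<le> real (covering_number A W) * real (covering_number K V)"
        by (metis of_nat_le_iff of_nat_mult)
      then show ?thesis using Kpos[OF V] by (simp add: divide_le_eq)
    qed
    then show ?thesis by (auto simp: Box_def r_def b_def)
  qed
  define S where "S V = closure {r V' |V'. V' \<in> NB \<and> V' \<subseteq> V}" for V
  have "Box \<inter> \<Inter>(S ` NB) \<noteq> {}"
  proof (rule compact_imp_fip[OF compact])
    show "\<And>C. C \<in> S ` NB \<Longrightarrow> closed C" by (auto simp: S_def)
    fix F' assume "finite F'" "F' \<subseteq> S ` NB"
    then obtain VS where VS: "finite VS" "VS \<subseteq> NB" "F' = S ` VS" by (metis finite_subset_image)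
    \<comment> \<open>Intersecting with the whole space takes care of the empty family.\<close>
    define V0 where "V0 = topspace T \<inter> \<Inter>VS"
    have "openin T V0"
      using VS unfolding V0_def by (cases "VS = {}") (auto simp: NB_def simp del: topspace_eq intro!: openin_Int openin_Inter)
    then have "V0 \<in> NB" using VS by (auto simp: NB_def V0_def topspace_eq)
    moreover have "r V0 \<in> S V" if "V \<in> VS" for V
      unfolding S_def using \<open>V0 \<in> NB\<close> that by (intro subsetD[OF closure_subset]) (auto simp: V0_def)
    ultimately show "Box \<inter> \<Inter>F' \<noteq> {}" using r_Box[of V0] VS(3) by blast
  qed
  then obtain l where lBox: "l \<in> Box" and lS: "\<And>V. V \<in> NB \<Longrightarrow> l \<in> S V" by blast
  have transfer: "l \<in> C" if "closed C" "V \<in> NB" "\<And>V'. V' \<in> NB \<Longrightarrow> V' \<subseteq> V \<Longrightarrow> r V' \<in> C" for C V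
  proof -
    have "S V \<subseteq> C" unfolding S_def using that by (intro closure_minimal) auto
    then show ?thesis using lS[OF that(2)] by blast
  qed
  have top: "topspace T \<in> NB" using topspace_eq one_closed openin_topspace[of T] by (simp add: NB_def)
  have "compact_content T l"
  proof
    show "0 \<le> l A" for A using lBox by (auto simp: Box_def PiE_iff)
    fix A B assume AB: "compactin T A" "compactin T B"
    show "l A \<le> l B" if "A \<subseteq> B"
    proof -
      have "l \<in> {f. f A \<le> f B}"
      proof (rule transfer[OF _ top])
        show "closed {f::'a set \<Rightarrow> real. f A \<le> f B}"
          by (intro closed_Collect_le continuous_on_product_coordinates)
        show "r V \<in> {f. f A \<le> f B}" if "V \<in> NB" for V
          using covering_number_mono[OF AB(2) _ _ \<open>A \<subseteq> B\<close>] that AB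
          by (auto simp: r_def NB_def divide_right_mono)
      qed
      then show ?thesis by simp
    qed
    show "l (A \<union> B) \<le> l A + l B"
    proof -
      have "l \<in> {f. f (A \<union> B) \<le> f A + f B}"
      proof (rule transfer[OF _ top])
        show "closed {f::'a set \<Rightarrow> real. f (A \<union> B) \<le> f A + f B}"
          by (intro closed_Collect_le continuous_on_product_coordinates continuous_on_add)
        show "r V \<in> {f. f (A \<union> B) \<le> f A + f B}" if "V \<in> NB" for V
        proof -
          have "real (covering_number (A \<union> B) V) \<le> real (covering_number A V) + real (covering_number B V)"
            using covering_number_Un[OF AB, of V] that by (simp add: NB_def flip: of_nat_add)
          then show ?thesis using AB
            by (auto simp: r_def compactin_Un add_divide_distrib[symmetric] divide_right_mono)
        qed
      qed
      then show ?thesis by simp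
    qed
    show "l A + l B \<le> l (A \<union> B)" if disj: "A \<inter> B = {}"
    proof -
      obtain V where V: "openin T V" "\<one> \<in> V"
        "\<And>V' g. V' \<subseteq> V \<Longrightarrow> g \<in> carrier G \<Longrightarrow> (g <# V') \<inter> A = {} \<or> (g <# V') \<inter> B = {}"
        using separating_neighbourhood[OF AB disj] by blast
      have "l \<in> {f. f A + f B \<le> f (A \<union> B)}"
      proof (rule transfer[of _ V])
        show "closed {f::'a set \<Rightarrow> real. f A + f B \<le> f (A \<union> B)}"
          by (intro closed_Collect_le continuous_on_product_coordinates continuous_on_add)
        show "V \<in> NB" using V by (simp add: NB_def)
        show "r V' \<in> {f. f A + f B \<le> f (A \<union> B)}" if V': "V' \<in> NB" "V' \<subseteq> V" for V'
        proof -
          have "real (covering_number A V') + real (covering_number B V') \<le> real (covering_number (A \<union> B) V')"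
            using covering_number_superadd[OF AB _ _ V(3)[OF V'(2)]] V' by (simp add: NB_def flip: of_nat_add)
          then show ?thesis using AB
            by (auto simp: r_def compactin_Un add_divide_distrib[symmetric] divide_right_mono)
        qed
      qed
      then show ?thesis by simp
    qed
  qed (rule Hausdorff locally_compact)+
  moreover have "l (g <# A) = l A" if "g \<in> carrier G" "compactin T A" for g A
  proof -
    have "l \<in> {f. f (g <# A) = f A}"
    proof (rule transfer[OF _ top])
      show "closed {f::'a set \<Rightarrow> real. f (g <# A) = f A}"
        by (intro closed_Collect_eq continuous_on_product_coordinates)
    qed (use that in \<open>auto simp: r_def NB_def compactin_lcos covering_number_lcos\<close>)
    then show ?thesis by simp
  qed
  moreover have "l K = 1"
  proof -
    have "l \<in> {f. f K = 1}"
    proof (rule transfer[OF _ top])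
      show "closed {f::'a set \<Rightarrow> real. f K = 1}"
        by (intro closed_Collect_eq continuous_on_product_coordinates continuous_on_const)
    qed (use Kpos W in \<open>auto simp: r_def\<close>)
    then show ?thesis by simp
  qed
  ultimately show thesis using that W(2) by blast
qed

lemma left_haar_measure_exists: "\<exists>M. left_haar_measure G T M"
proof -
  obtain l K where l: "compact_content T l"
    and inv: "\<And>g A. g \<in> carrier G \<Longrightarrow> compactin T A \<Longrightarrow> l (g <# A) = l A"
    and K: "compactin T K" "l K = 1" using invariant_content_exists by blast
  interpret compact_content T l by (rule l)
  have inner_le: "inner_content (g <# U) \<le> inner_content U" if g: "g \<in> carrier G" and U: "U \<subseteq> carrier G" for g U
    unfolding inner_content_def[of "g <# U"]
  proof (rule SUP_least, clarsimp)
    fix C assume C: "compactin T C" "C \<subseteq> g <# U"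
    have "inv g <# C \<subseteq> inv g <# (g <# U)" using C(2) by (auto simp: lcos_eq_image)
    then have "inv g <# C \<subseteq> U" using inv_lcos_lcos[OF g U] by simp
    then have "ennreal (l (inv g <# C)) \<le> inner_content U"
      using g C by (intro content_le_inner compactin_lcos) auto
    then show "ennreal (l C) \<le> inner_content U" using inv[of "inv g" C] g C by simp
  qed
  have outer_le: "outer_content (g <# B) \<le> outer_content B" if g: "g \<in> carrier G" for g B
    unfolding outer_content_def[of B]
  proof (rule INF_greatest, clarsimp)
    fix U assume U: "openin T U" "B \<subseteq> U"
    have "outer_content (g <# B) \<le> inner_content (g <# U)"
      unfolding outer_content_def using U g by (intro INF_lower) (auto simp: lcos_eq_image intro: openin_lcos[unfolded lcos_eq_image])
    also have "\<dots> \<le> inner_content U" using inner_le[OF g] openin_subset[OF U(1)] topspace_eq by simp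
    finally show "outer_content (g <# B) \<le> inner_content U" .
  qed
  have outer_eq: "outer_content (g <# B) = outer_content B" if g: "g \<in> carrier G" "B \<subseteq> carrier G" for g B
    using outer_le[OF g(1), of B] outer_le[of "inv g" "g <# B"] g by (simp add: inv_lcos_lcos)
  let ?M = content_measure
  have space: "space ?M = carrier G"
    unfolding content_measure_def using open_subset_Pow topspace_eq by (simp add: space_measure_of)
  have lcos_sets: "g <# B \<in> sets ?M" if "g \<in> carrier G" "B \<in> sets ?M" for g B
    unfolding lcos_eq_image
    by (rule homeomorphic_image_borel[OF homeomorphic_map_left_mult sets_content_measure sets_content_measure])
      (use that in auto)
  have "left_haar_measure G T ?M"
    unfolding left_haar_measure_def
  proof (intro conjI ballI allI impI)
    show "sets ?M = sets (sigma (topspace T) {U. openin T U})" by (rule sets_content_measure)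
    have "0 < ennreal (l K)" using K by simp
    also have "\<dots> \<le> emeasure ?M K" by (rule content_le_content_measure[OF K(1)])
    also have "\<dots> \<le> emeasure ?M (space ?M)" by (rule emeasure_space)
    finally show "emeasure ?M (space ?M) \<noteq> 0" by simp
    show "emeasure ?M (g <# B) = emeasure ?M B" if "g \<in> carrier G" "B \<in> sets ?M" for g B
      using that lcos_sets[OF that] outer_eq[of g B] sets.sets_into_space[OF that(2)] space
      by (simp add: emeasure_content_measure)
  qed (use content_measure_compact_finite content_measure_outer_regular content_measure_inner_regular in blast)+
  then show ?thesis by blast
qed

end

section \<open>Null slices of compact subsets of a product\<close>

text \<open>
  For \<open>\<epsilon> > 0\<close> enclose each null slice over \<open>x\<close> in an open set \<open>V x\<close> of measure at most \<open>\<epsilon>\<close>. By the tube lemma \<open>V x\<close> also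
  contains the slices over a neighbourhood of \<open>x\<close>. Finitely many of these neighbourhoods cover \<open>A\<close>; cutting
  them down to a Borel partition \<open>P i\<close> of \<open>A\<close> covers \<open>Z\<close> by rectangles \<open>P i \<times> V (f i)\<close>. Integrating the resulting
  bound for the other slices over \<open>B\<close> gives \<open>c N(B) \<le> \<epsilon> M(A)\<close>.
\<close>

lemma null_product_slices:
  fixes X :: "'a topology" and Y :: "'b topology"
  assumes A: "compactin X A" and B: "compactin Y B" and HX: "Hausdorff_space X" 
    and Z: "closedin (prod_topology X Y) Z" "Z \<subseteq> A \<times> B"
    and M: "sets M = sets (sigma (topspace X) {U. openin X U})" and finA: "emeasure M A < \<infinity>"
    and N: "sets N = sets (sigma (topspace Y) {U. openin Y U})" and BN: "B \<in> sets N"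
    and null: "\<And>x e. x \<in> A \<Longrightarrow> 0 < e \<Longrightarrow>
      \<exists>V. openin Y V \<and> {y. (x, y) \<in> Z} \<subseteq> V \<and> emeasure N V \<le> ennreal e"
    and lower: "\<And>y. y \<in> B \<Longrightarrow> c \<le> emeasure M {x. (x, y) \<in> Z}"
  shows "c * emeasure N B = 0"
proof -
  note openM = open_in_borel_sets[OF M] and openN = open_in_borel_sets[OF N]
  have AM: "A \<in> sets M" using closed_in_borel_sets[OF M compactin_imp_closedin[OF HX A]] .
  have bound: "c * emeasure N B \<le> ennreal e * emeasure M A" if e: "0 < e" for e
  proof -
    obtain V where V: "\<And>x. x \<in> A \<Longrightarrow> openin Y (V x)" "\<And>x. x \<in> A \<Longrightarrow> {y. (x, y) \<in> Z} \<subseteq> V x"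
      "\<And>x. x \<in> A \<Longrightarrow> emeasure N (V x) \<le> ennreal e"
      using null[OF _ e] by metis
    have "\<exists>U. openin X U \<and> x \<in> U \<and> (\<forall>x' y. x' \<in> U \<longrightarrow> (x', y) \<in> Z \<longrightarrow> y \<in> V x)" if x: "x \<in> A" for x
    proof -
      \<comment> \<open>The open set of all points that are either outside \<open>Z\<close> or have second coordinate in \<open>V x\<close>.\<close>
      define W where "W = (topspace (prod_topology X Y) - Z) \<union> topspace X \<times> V x"
      have "openin (prod_topology X Y) W"
        unfolding W_def using Z(1) V(1)[OF x]
        by (intro openin_Un openin_diff) (auto simp: openin_prod_Times_iff)
      moreover have xX: "x \<in> topspace X" using compactin_subset_topspace[OF A] x by auto
      moreover have "{x} \<times> B \<subseteq> W"
        using V(2)[OF x] xX compactin_subset_topspace[OF B] by (auto simp: W_def)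
      ultimately obtain U V' where "openin X U" "x \<in> U" "B \<subseteq> V'" "U \<times> V' \<subseteq> W"
        using tube_lemma_right[OF _ B] by metis
      then have "\<forall>x' y. x' \<in> U \<longrightarrow> (x', y) \<in> Z \<longrightarrow> y \<in> V x"
        using Z(2) unfolding W_def by blast
      then show ?thesis using \<open>openin X U\<close> \<open>x \<in> U\<close> by blast
    qed
    then obtain U where U: "\<And>x. x \<in> A \<Longrightarrow> openin X (U x)" "\<And>x. x \<in> A \<Longrightarrow> x \<in> U x"
      "\<And>x x' y. x \<in> A \<Longrightarrow> x' \<in> U x \<Longrightarrow> (x', y) \<in> Z \<Longrightarrow> y \<in> V x" by metis
    have "\<exists>\<F>. finite \<F> \<and> \<F> \<subseteq> U ` A \<and> A \<subseteq> \<Union>\<F>"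
    proof -
      have "(\<forall>S\<in>U ` A. openin X S) \<and> A \<subseteq> \<Union>(U ` A)" using U(1,2) by blast
      then show ?thesis using A unfolding compactin_def by meson
    qed
    then obtain F where F: "finite F" "F \<subseteq> A" "A \<subseteq> \<Union>(U ` F)" by (metis finite_subset_image)
    obtain f :: "nat \<Rightarrow> 'a" and n where f: "F = f ` {..<n}"
      using F(1) by (metis finite_imp_nat_seg_image_inj_on lessThan_def)
    define P where "P i = A \<inter> U (f i) - (\<Union>j<i. U (f j))" for i
    have fA: "f i \<in> A" if "i < n" for i using F(2) f that by auto
    have PM: "P i \<in> sets M" if "i < n" for i
    proof -
      have "U (f j) \<in> sets M" if "j < n" for j using openM U(1) fA that by blast
      then show ?thesis unfolding P_def using that AM
        by (intro sets.Diff sets.Int sets.finite_UN) auto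
    qed
    have disj: "disjoint_family_on P {..<n}"
    proof -
      have "P i \<inter> P j = {}" if "i < j" for i j using that by (auto simp: P_def)
      then show ?thesis unfolding disjoint_family_on_def by (metis Int_commute linorder_neqE_nat)
    qed
    have cover: "\<exists>i<n. x \<in> P i" if "x \<in> A" for x
    proof -
      have ex: "\<exists>i. i < n \<and> x \<in> U (f i)" using F(3) f that by auto
      define i where "i = (LEAST i. i < n \<and> x \<in> U (f i))"
      have i: "i < n \<and> x \<in> U (f i)" unfolding i_def by (rule LeastI_ex[OF ex])
      moreover have "x \<notin> U (f j)" if "j < i" for j
        using not_less_Least[OF that[unfolded i_def]] that i by auto
      ultimately show ?thesis using that by (auto simp: P_def)
    qed
    have *: "c \<le> (\<Sum>i<n. emeasure M (P i) * indicator (V (f i)) y)" if y: "y \<in> B" for y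
    proof -
      let ?I = "{i. i < n \<and> y \<in> V (f i)}"
      have "{x. (x, y) \<in> Z} \<subseteq> (\<Union>i\<in>?I. P i)"
      proof
        fix x assume x: "x \<in> {x. (x, y) \<in> Z}"
        then obtain i where "i < n" "x \<in> P i" using cover Z(2) by blast
        moreover from this have "y \<in> V (f i)" using U(3)[OF fA, of i x y] x by (auto simp: P_def)
        ultimately show "x \<in> (\<Union>i\<in>?I. P i)" by blast
      qed
      then have "emeasure M {x. (x, y) \<in> Z} \<le> emeasure M (\<Union>i\<in>?I. P i)"
        using PM by (intro emeasure_mono sets.finite_UN) auto
      also have "\<dots> \<le> (\<Sum>i\<in>?I. emeasure M (P i))"
        using PM by (intro emeasure_subadditive_finite) auto
      also have "\<dots> = (\<Sum>i<n. emeasure M (P i) * indicator (V (f i)) y)"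
        by (intro sum.mono_neutral_cong_left) auto
      finally show ?thesis using lower[OF y] by simp
    qed
    have "(\<Sum>i<n. emeasure M (P i)) = emeasure M (\<Union>i<n. P i)"
      using PM disj by (intro sum_emeasure) auto
    also have "\<dots> \<le> emeasure M A"
      using AM by (intro emeasure_mono) (auto simp: P_def)
    finally have PA: "(\<Sum>i<n. emeasure M (P i)) \<le> emeasure M A" .
    have "c * emeasure N B = (\<integral>\<^sup>+y. c * indicator B y \<partial>N)"
      by (rule nn_integral_cmult_indicator[OF BN, symmetric])
    also have "\<dots> \<le> (\<integral>\<^sup>+y. (\<Sum>i<n. emeasure M (P i) * indicator (V (f i)) y) \<partial>N)"
      by (intro nn_integral_mono) (use * in \<open>auto simp: indicator_def\<close>)
    also have "\<dots> = (\<Sum>i<n. \<integral>\<^sup>+y. emeasure M (P i) * indicator (V (f i)) y \<partial>N)"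
      using openN[OF V(1)[OF fA]] by (intro nn_integral_sum) auto
    also have "\<dots> = (\<Sum>i<n. emeasure M (P i) * emeasure N (V (f i)))"
      using openN[OF V(1)[OF fA]] by (intro sum.cong nn_integral_cmult_indicator) auto
    also have "\<dots> \<le> (\<Sum>i<n. emeasure M (P i) * ennreal e)"
      by (intro sum_mono mult_left_mono V(3) fA) auto
    also have "\<dots> = (\<Sum>i<n. emeasure M (P i)) * ennreal e"
      by (simp add: sum_distrib_right)
    also have "\<dots> \<le> emeasure M A * ennreal e"
      by (rule mult_right_mono[OF PA]) simp
    finally show ?thesis by (simp add: mult.commute)
  qed
  obtain m where m: "0 \<le> m" "emeasure M A = ennreal m"
    using finA by (cases "emeasure M A") auto
  have "c * emeasure N B \<le> 0"
  proof (rule ennreal_le_epsilon)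
    fix d :: real assume "0 < d"
    then have "c * emeasure N B \<le> ennreal (d / (m + 1)) * ennreal m"
      using bound[of "d / (m + 1)"] m by simp
    also have "\<dots> = ennreal (d / (m + 1) * m)"
      using \<open>0 < d\<close> m by (intro ennreal_mult[symmetric]) auto
    also have "\<dots> \<le> ennreal d"
      using \<open>0 < d\<close> m by (intro ennreal_leI) (simp add: field_simps)
    finally show "c * emeasure N B \<le> 0 + ennreal d" by simp
  qed
  then show ?thesis by simp
qed

section \<open>Left Haar measures and closed subgroups\<close>

locale sigma_compact_group = locally_compact_group G T for G (structure) and T +
  assumes sigma_compact: "sigma_compact_space T"

context locally_compact_group
begin

lemma haar_sets: "left_haar_measure G T M \<Longrightarrow> sets M = sets (sigma (topspace T) {U. openin T U})"
  by (simp add: left_haar_measure_def)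

lemma haar_space: "left_haar_measure G T M \<Longrightarrow> space M = carrier G"
  using space_of_borel_sets[OF haar_sets] topspace_eq by simp

lemma haar_measure_left_haar: "left_haar_measure G T (haar_measure G T)"
  unfolding haar_measure_def by (rule someI_ex[OF left_haar_measure_exists])

lemma compact_subset_carrier: "compactin T C \<Longrightarrow> C \<subseteq> carrier G"
  using compactin_subset_topspace topspace_eq by metis

lemma haar_compact_sets: "left_haar_measure G T M \<Longrightarrow> compactin T C \<Longrightarrow> C \<in> sets M"
  using closed_in_borel_sets[OF haar_sets] compactin_imp_closedin[OF Hausdorff] by blast

lemma haar_compact_finite: "left_haar_measure G T M \<Longrightarrow> compactin T C \<Longrightarrow> emeasure M C < \<infinity>"
  by (simp add: left_haar_measure_def)

lemma haar_left_invariant: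
  "left_haar_measure G T M \<Longrightarrow> g \<in> carrier G \<Longrightarrow> B \<in> sets M \<Longrightarrow> emeasure M (g <# B) = emeasure M B"
  by (simp add: left_haar_measure_def)

lemma haar_lcos_sets:
  assumes "left_haar_measure G T M" "g \<in> carrier G" "B \<in> sets M" shows "g <# B \<in> sets M"
  unfolding lcos_eq_image
  using homeomorphic_image_borel[OF homeomorphic_map_left_mult haar_sets haar_sets] assms by blast

lemma haar_null_open_cover:
  assumes M: "left_haar_measure G T M" and B: "B \<in> sets M" "emeasure M B = 0" and e: "0 < (e::real)"
  shows "\<exists>V. openin T V \<and> B \<subseteq> V \<and> emeasure M V \<le> ennreal e"
proof -
  have "emeasure M B = (INF U \<in> {U. openin T U \<and> B \<subseteq> U}. emeasure M U)"
    using M B(1) unfolding left_haar_measure_def by blast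
  then have "(INF U \<in> {U. openin T U \<and> B \<subseteq> U}. emeasure M U) < ennreal e"
    using B(2) e by simp
  then show ?thesis unfolding INF_less_iff by (auto intro: less_imp_le)
qed

lemma haar_compact_positive:
  assumes M: "left_haar_measure G T M"
  obtains C where "compactin T C" "emeasure M C \<noteq> 0"
proof -
  have "(SUP K \<in> {K. compactin T K \<and> K \<subseteq> topspace T}. emeasure M K) = emeasure M (topspace T)"
    using M openin_topspace[of T] unfolding left_haar_measure_def by metis
  also have "\<dots> \<noteq> 0"
    using M space_of_borel_sets[OF haar_sets[OF M]] unfolding left_haar_measure_def by metis
  finally have "(SUP K \<in> {K. compactin T K \<and> K \<subseteq> topspace T}. emeasure M K) \<noteq> 0" .
  then have "\<not> (SUP K \<in> {K. compactin T K \<and> K \<subseteq> topspace T}. emeasure M K) \<le> 0" by simp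
  then obtain K where "compactin T K" "emeasure M K \<noteq> 0"
    unfolding SUP_le_iff by auto
  then show thesis using that by blast
qed

end

lemma closed_subgroup_locally_compact_group:
  fixes G (structure)
  assumes "locally_compact_group G T" and H: "closed_subgroup G T H"
  shows "locally_compact_group (G\<lparr>carrier := H\<rparr>) (subtopology T H)"
proof -
  interpret locally_compact_group G T by fact
  have sub: "subgroup H G" and cl: "closedin T H" using H by (auto simp: closed_subgroup_def)
  interpret H: group "G\<lparr>carrier := H\<rparr>" by (rule subgroup_imp_group[OF sub])
  have ts: "topspace (subtopology T H) = H" using closedin_subset[OF cl] by auto
  let ?S = "subtopology T H"
  have "continuous_map (prod_topology ?S ?S) T (\<lambda>p. fst p \<otimes> snd p)"
    by (intro continuous_map_group_mult) 
      (metis continuous_map_fst continuous_map_into_fulltopology, metis continuous_map_snd continuous_map_into_fulltopology)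
  then have mult: "continuous_map (prod_topology ?S ?S) ?S (\<lambda>(x, y). x \<otimes> y)"
    using subgroup.m_closed[OF sub] ts
    by (auto simp: continuous_map_in_subtopology split_def image_subset_iff)
  have "continuous_map ?S T (\<lambda>x. inv x)"
    using continuous_inv continuous_map_from_subtopology by blast
  then have "continuous_map ?S ?S (\<lambda>x. inv x)"
    using subgroup.m_inv_closed[OF sub] ts by (auto simp: continuous_map_in_subtopology)
  then have "continuous_map ?S ?S (\<lambda>x. inv\<^bsub>G\<lparr>carrier := H\<rparr>\<^esub> x)"
    by (rule continuous_map_eq) (use ts m_inv_consistent[OF sub] in auto)
  then show ?thesis
    using mult ts Hausdorff locally_compact cl
    by unfold_locales (auto simp: Hausdorff_space_subtopology locally_compact_space_closed_subset)
qed

lemma closed_subgroup_sigma_compact_group: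
  fixes G (structure)
  assumes "sigma_compact_group G T" and H: "closed_subgroup G T H"
  shows "sigma_compact_group (G\<lparr>carrier := H\<rparr>) (subtopology T H)"
proof -
  interpret sigma_compact_group G T by fact
  interpret H: locally_compact_group "G\<lparr>carrier := H\<rparr>" "subtopology T H"
    using closed_subgroup_locally_compact_group locally_compact_group_axioms H by blast
  have cl: "closedin T H" using H by (auto simp: closed_subgroup_def)
  obtain K :: "nat \<Rightarrow> 'a set" where K: "\<And>n. compactin T (K n)" "(\<Union>n. K n) = topspace T"
    using sigma_compact by (auto simp: sigma_compact_space_def)
  have "sigma_compact_space (subtopology T H)"
    unfolding sigma_compact_space_def
  proof (intro exI[of _ "\<lambda>n. K n \<inter> H"] conjI allI)
    show "compactin (subtopology T H) (K n \<inter> H)" for n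
      using K(1) cl by (simp add: compactin_subtopology compact_Int_closedin)
    show "(\<Union>n. K n \<inter> H) = topspace (subtopology T H)" using K(2) by auto
  qed
  then show ?thesis by unfold_locales
qed

context locally_compact_group
begin

text \<open>
  The two versions differ in the order of the factors, since the null slice principle is used in
  both directions.
\<close>

lemma closedin_left_quotient_preimage:
  assumes K: "closed_subgroup G T K" and C: "compactin T C"
  and A: "compactin T A" and B: "compactin T B" "B \<subseteq> K"
  shows "closedin (prod_topology T (subtopology T K)) {(x, k). x \<in> A \<and> k \<in> B \<and> inv x \<otimes> k \<in> C}"
    and "closedin (prod_topology (subtopology T K) T) {(k, x). x \<in> A \<and> k \<in> B \<and> inv x \<otimes> k \<in> C}"
proof -
  let ?S = "subtopology T K"
  have KT: "closedin T K" using K by (simp add: closed_subgroup_def)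
  have cB: "closedin ?S B"
    using B compactin_imp_closedin[OF Hausdorff_space_subtopology[OF Hausdorff]] by (simp add: compactin_subtopology)
  have cA: "closedin T A" and cC: "closedin T C"
    using A C compactin_imp_closedin[OF Hausdorff] by auto
  have "continuous_map (prod_topology T ?S) T (\<lambda>p. inv (fst p) \<otimes> snd p)"
    by (intro continuous_map_group_mult continuous_map_group_inv)
      (rule continuous_map_fst, metis continuous_map_snd continuous_map_into_fulltopology)
  then have "closedin (prod_topology T ?S) ({p \<in> topspace (prod_topology T ?S). inv (fst p) \<otimes> snd p \<in> C} \<inter> A \<times> B)"
    by (intro closedin_Int closedin_continuous_map_preimage[of _ T])
      (use cA cB cC in \<open>auto simp: closedin_prod_Times_iff\<close>)
  also have "({p \<in> topspace (prod_topology T ?S). inv (fst p) \<otimes> snd p \<in> C} \<inter> A \<times> B)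
    = {(x, k). x \<in> A \<and> k \<in> B \<and> inv x \<otimes> k \<in> C}"
    using closedin_subset[OF cA] closedin_subset[OF cB] by auto
  finally show "closedin (prod_topology T ?S) {(x, k). x \<in> A \<and> k \<in> B \<and> inv x \<otimes> k \<in> C}" .
  have "continuous_map (prod_topology ?S T) T (\<lambda>p. inv (snd p) \<otimes> fst p)"
    by (intro continuous_map_group_mult continuous_map_group_inv)
      (rule continuous_map_snd, metis continuous_map_fst continuous_map_into_fulltopology)
  then have "closedin (prod_topology ?S T) ({p \<in> topspace (prod_topology ?S T). inv (snd p) \<otimes> fst p \<in> C} \<inter> B \<times> A)"
    by (intro closedin_Int closedin_continuous_map_preimage[of _ T])
      (use cA cB cC in \<open>auto simp: closedin_prod_Times_iff\<close>)
  also have "({p \<in> topspace (prod_topology ?S T). inv (snd p) \<otimes> fst p \<in> C} \<inter> B \<times> A)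
    = {(k, x). x \<in> A \<and> k \<in> B \<and> inv x \<otimes> k \<in> C}"
    using closedin_subset[OF cA] closedin_subset[OF cB] by auto
  finally show "closedin (prod_topology ?S T) {(k, x). x \<in> A \<and> k \<in> B \<and> inv x \<otimes> k \<in> C}" .
qed

lemma emeasure_subset_null:
  assumes "A \<in> sets M" "emeasure M A = 0" "B \<subseteq> A" shows "emeasure M B = 0"
  using emeasure_mono[OF assms(3,1)] assms(2) by simp

text \<open>
  Consider the pairs \<open>(x, k)\<close> with \<open>x\<^sup>-\<^sup>1 k \<in> C\<close>, where \<open>k\<close> ranges over a compact subset \<open>B\<close> of \<open>K\<close> that is not
  null. The slice over \<open>x\<close> lies in the null set \<open>x C \<inter> K\<close>. The slice over \<open>k\<close> is \<open>k C\<^sup>-\<^sup>1\<close>, once \<open>x\<close> is allowed to range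
  over \<open>B C\<^sup>-\<^sup>1\<close>, and its measure does not depend on \<open>k\<close>.
\<close>

lemma inverse_null_if_translates_null_on_subgroup:
  assumes K: "closed_subgroup G T K" and M: "left_haar_measure G T M"
    and N: "left_haar_measure (G\<lparr>carrier := K\<rparr>) (subtopology T K) N"
    and C: "compactin T C"
    and null: "\<And>x. x \<in> carrier G \<Longrightarrow> emeasure N ((x <# C) \<inter> K) = 0"
  shows "emeasure M ((\<lambda>x. inv x) ` C) = 0"
proof -
  interpret K: locally_compact_group "G\<lparr>carrier := K\<rparr>" "subtopology T K"
    using closed_subgroup_locally_compact_group locally_compact_group_axioms K by blast
  have KT: "closedin T K" and KG: "K \<subseteq> carrier G" using K by (auto simp: closed_subgroup_def subgroup.subset)
  obtain B where B: "compactin (subtopology T K) B" "emeasure N B \<noteq> 0"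
    using K.haar_compact_positive[OF N] .
  have BT: "compactin T B" "B \<subseteq> K" using B(1) by (auto simp: compactin_subtopology)
  define A where "A = B <#> (\<lambda>x. inv x) ` C"
  have A: "compactin T A"
    unfolding A_def by (intro compactin_set_mult compactin_inv_image BT C)
  note sub = compact_subset_carrier[OF A] compact_subset_carrier[OF C]
  let ?Z = "{(x, k). x \<in> A \<and> k \<in> B \<and> inv x \<otimes> k \<in> C}"
  have "emeasure M ((\<lambda>x. inv x) ` C) * emeasure N B = 0"
  proof (rule null_product_slices[where X = T and Y = "subtopology T K" and A = A and B = B and Z = ?Z and M = M and N = N])
    show "closedin (prod_topology T (subtopology T K)) ?Z"
      by (rule closedin_left_quotient_preimage(1)[OF K C A BT])
    show "B \<in> sets N" by (rule K.haar_compact_sets[OF N B(1)])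
    fix x and e :: real assume x: "x \<in> A" and e: "0 < e"
    let ?Q = "(x <# C) \<inter> K"
    have xG: "x \<in> carrier G" using x sub by auto
    have Q: "compactin (subtopology T K) ?Q"
      using compactin_lcos[OF xG C] KT by (simp add: compactin_subtopology compact_Int_closedin)
    obtain V where V: "openin (subtopology T K) V" "?Q \<subseteq> V" "emeasure N V \<le> ennreal e"
      using K.haar_null_open_cover[OF N K.haar_compact_sets[OF N Q] null[OF xG] e] by blast
    have "{k. (x, k) \<in> ?Z} \<subseteq> ?Q"
    proof
      fix k assume "k \<in> {k. (x, k) \<in> ?Z}"
      then have k: "k \<in> K" "inv x \<otimes> k \<in> C" using BT by auto
      have "k = x \<otimes> (inv x \<otimes> k)" using k xG KG by (simp add: m_assoc[symmetric] subset_iff)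
      then show "k \<in> ?Q" using k unfolding lcos_eq_image by blast
    qed
    then show "\<exists>V. openin (subtopology T K) V \<and> {k. (x, k) \<in> ?Z} \<subseteq> V \<and> emeasure N V \<le> ennreal e"
      using V by blast
  next
    fix k assume k: "k \<in> B"
    have kG: "k \<in> carrier G" using k BT KG by auto
    have "{x. (x, k) \<in> ?Z} = k <# ((\<lambda>x. inv x) ` C)"
    proof (intro equalityI subsetI)
      fix x assume "x \<in> {x. (x, k) \<in> ?Z}"
      then have x: "x \<in> A" "inv x \<otimes> k \<in> C" by auto
      then have "x = k \<otimes> inv (inv x \<otimes> k)" using kG sub by (simp add: inv_mult_group m_assoc[symmetric] subset_iff)
      then show "x \<in> k <# ((\<lambda>x. inv x) ` C)" using x unfolding lcos_eq_image by blast
    next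
      fix x assume "x \<in> k <# ((\<lambda>x. inv x) ` C)"
      then obtain c where c: "c \<in> C" "x = k \<otimes> inv c" by (auto simp: lcos_eq_image)
      then have "x \<in> A" using k unfolding A_def set_mult_def by blast
      moreover have "inv x \<otimes> k = c" using c kG sub by (simp add: inv_mult_group m_assoc subset_iff)
      ultimately show "x \<in> {x. (x, k) \<in> ?Z}" using c k by simp
    qed
    then show "emeasure M ((\<lambda>x. inv x) ` C) \<le> emeasure M {x. (x, k) \<in> ?Z}"
      using haar_left_invariant[OF M kG] haar_compact_sets[OF M] compactin_inv_image[OF C] by simp
  qed (use A B Hausdorff haar_sets[OF M] K.haar_sets[OF N] haar_compact_finite[OF M A] in auto)
  then show ?thesis using B(2) by simp
qed

lemma closed_subgroup_self: "closed_subgroup G T (carrier G)"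
  using closedin_topspace[of T] topspace_eq by (simp add: closed_subgroup_def subgroup_self)

text \<open>
  For \<open>K = G\<close> the slices \<open>x C\<close> are translates of \<open>C\<close>. The two measures may differ, so this comprises
  uniqueness of the null sets as well as their invariance under inversion.
\<close>

lemma inverse_null:
  assumes M: "left_haar_measure G T M" and N: "left_haar_measure G T N"
    and C: "compactin T C" and null: "emeasure N C = 0"
  shows "emeasure M ((\<lambda>x. inv x) ` C) = 0"
proof (rule inverse_null_if_translates_null_on_subgroup[OF closed_subgroup_self M _ C])
  have "subtopology T (carrier G) = T" using subtopology_topspace[of T] topspace_eq by simp
  then show "left_haar_measure (G\<lparr>carrier := carrier G\<rparr>) (subtopology T (carrier G)) N"
    using N by simp
  show "emeasure N ((x <# C) \<inter> carrier G) = 0" if "x \<in> carrier G" for x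
    using haar_left_invariant[OF N that haar_compact_sets[OF N C]] null compact_subset_carrier[OF compactin_lcos[OF that C]]
    by (simp add: Int_absorb2)
qed

lemma inv_image_inv_image: "X \<subseteq> carrier G \<Longrightarrow> (\<lambda>x. inv x) ` (\<lambda>x. inv x) ` X = X"
  by (force simp: image_image subset_iff)

lemma inverse_null_iff:
  assumes M: "left_haar_measure G T M" and C: "compactin T C"
  shows "emeasure M ((\<lambda>x. inv x) ` C) = 0 \<longleftrightarrow> emeasure M C = 0"
  using inverse_null[OF M M C] inverse_null[OF M M compactin_inv_image[OF C]]
    inv_image_inv_image[OF compact_subset_carrier[OF C]] by auto

lemma compact_null_unique:
  assumes M: "left_haar_measure G T M" and N: "left_haar_measure G T N"
    and C: "compactin T C" and null: "emeasure N C = 0"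
  shows "emeasure M C = 0"
  using inverse_null[OF M N C null] inverse_null_iff[OF M C] by simp

text \<open>
  The same pairs \<open>(x, k)\<close> as before, for the compact set \<open>C D\<close>, with the roles of the factors exchanged. The
  slices over \<open>k\<close> lie in translates of \<open>(C D)\<^sup>-\<^sup>1\<close> and are null. For \<open>x = (h k)\<^sup>-\<^sup>1\<close> with \<open>h \<in> C\<close> and \<open>k \<in> E\<close>
  the slice over \<open>x\<close> contains \<open>k\<^sup>-\<^sup>1 D\<close>. Since these \<open>x\<close> form a set that is not null, \<open>D\<close> must be null.
\<close>

lemma null_on_subgroup_if_product_null:
  assumes K: "closed_subgroup G T K" and M: "left_haar_measure G T M"
    and N: "left_haar_measure (G\<lparr>carrier := K\<rparr>) (subtopology T K) N"
    and C: "compactin T C" and D: "compactin T D" "D \<subseteq> K" and E: "compactin T E" "E \<subseteq> K"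
    and null: "emeasure M (C <#> D) = 0" and pos: "emeasure M (C <#> E) \<noteq> 0"
  shows "emeasure N D = 0"
proof -
  interpret K: locally_compact_group "G\<lparr>carrier := K\<rparr>" "subtopology T K"
    using closed_subgroup_locally_compact_group locally_compact_group_axioms K by blast
  have KT: "closedin T K" and KG: "K \<subseteq> carrier G" and Ksub: "subgroup K G"
    using K by (auto simp: closed_subgroup_def subgroup.subset)
  define A where "A = (\<lambda>x. inv x) ` (C <#> E)"
  define B where "B = (\<lambda>x. inv x) ` E <#> D"
  have CE: "compactin T (C <#> E)" and CD: "compactin T (C <#> D)"
    by (intro compactin_set_mult C D E)+
  have A: "compactin T A" unfolding A_def by (intro compactin_inv_image CE)
  have B: "compactin T B"
    unfolding B_def by (intro compactin_set_mult compactin_inv_image D E)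
  have BKs: "B \<subseteq> K"
  proof
    fix y assume "y \<in> B"
    then obtain x d where "x \<in> E" "d \<in> D" "y = inv x \<otimes> d" by (auto simp: B_def set_mult_def)
    then show "y \<in> K"
      using D(2) E(2) subgroup.m_closed[OF Ksub] subgroup.m_inv_closed[OF Ksub] by blast
  qed
  note B = B BKs
  have BK: "compactin (subtopology T K) B" and DK: "compactin (subtopology T K) D"
    using B D by (simp_all add: compactin_subtopology)
  note sub = compact_subset_carrier[OF A] compact_subset_carrier[OF C] compact_subset_carrier[OF D(1)] compact_subset_carrier[OF E(1)] compact_subset_carrier[OF CD]
  let ?Z = "{(k, x). x \<in> A \<and> k \<in> B \<and> inv x \<otimes> k \<in> C <#> D}"
  have posA: "emeasure M A \<noteq> 0"
    unfolding A_def using inverse_null_iff[OF M CE] pos by simp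
  have nullI: "emeasure M ((\<lambda>x. inv x) ` (C <#> D)) = 0"
    by (rule inverse_null[OF M M CD null])
  have "emeasure N D * emeasure M A = 0"
  proof (rule null_product_slices[where X = "subtopology T K" and Y = T and A = B and B = A and Z = ?Z and M = N and N = M])
    show "closedin (prod_topology (subtopology T K) T) ?Z"
      by (rule closedin_left_quotient_preimage(2)[OF K CD A B])
    show "A \<in> sets M" by (rule haar_compact_sets[OF M A])
    fix k and e :: real assume k: "k \<in> B" and e: "0 < e"
    have kG: "k \<in> carrier G" using k B KG by auto
    let ?Q = "k <# (\<lambda>x. inv x) ` (C <#> D)"
    have Q: "?Q \<in> sets M" "emeasure M ?Q = 0"
      using haar_lcos_sets[OF M kG] haar_left_invariant[OF M kG] haar_compact_sets[OF M compactin_inv_image[OF CD]] nullI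
      by auto
    have "{x. (k, x) \<in> ?Z} \<subseteq> ?Q"
    proof
      fix x assume "x \<in> {x. (k, x) \<in> ?Z}"
      then have x: "x \<in> A" "inv x \<otimes> k \<in> C <#> D" by auto
      then have "x = k \<otimes> inv (inv x \<otimes> k)" using kG sub by (simp add: inv_mult_group m_assoc[symmetric] subset_iff)
      then show "x \<in> ?Q" using x unfolding lcos_eq_image by blast
    qed
    then show "\<exists>V. openin T V \<and> {x. (k, x) \<in> ?Z} \<subseteq> V \<and> emeasure M V \<le> ennreal e"
      using haar_null_open_cover[OF M Q e] by blast
  next
    fix x assume x: "x \<in> A"
    then obtain h k where hk: "h \<in> C" "k \<in> E" "x = inv (h \<otimes> k)" by (auto simp: A_def set_mult_def)
    have G: "h \<in> carrier G" "k \<in> carrier G" "k \<in> K" using hk sub E by auto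
    have kK: "inv k \<in> K" using subgroup.m_inv_closed[OF Ksub] G by blast
    have "inv k <# D \<subseteq> {k. (k, x) \<in> ?Z}"
    proof
      fix y assume "y \<in> inv k <# D"
      then obtain d where d: "d \<in> D" "y = inv k \<otimes> d" by (auto simp: lcos_eq_image)
      have "y \<in> B" using d hk unfolding B_def set_mult_def by blast
      moreover have "inv x \<otimes> y = h \<otimes> d" using d hk G sub
        by (simp add: m_assoc subset_iff) (simp add: m_assoc[symmetric])
      moreover have "h \<otimes> d \<in> C <#> D" using hk d unfolding set_mult_def by blast
      ultimately show "y \<in> {k. (k, x) \<in> ?Z}" using x by simp
    qed
    moreover have "{k. (k, x) \<in> ?Z} \<in> sets N"
    proof -
      have "{k. (k, x) \<in> ?Z} = B \<inter> ((x <# (C <#> D)) \<inter> K)"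
      proof (intro equalityI subsetI)
        fix k' assume "k' \<in> {k. (k, x) \<in> ?Z}"
        then have k': "k' \<in> B" "inv x \<otimes> k' \<in> C <#> D" by auto
        have "k' = x \<otimes> (inv x \<otimes> k')" using k' B KG x sub by (simp add: m_assoc[symmetric] subset_iff)
        then show "k' \<in> B \<inter> ((x <# (C <#> D)) \<inter> K)" using k' B unfolding lcos_eq_image by blast
      next
        fix k' assume "k' \<in> B \<inter> ((x <# (C <#> D)) \<inter> K)"
        then obtain z where z: "k' \<in> B" "z \<in> C <#> D" "k' = x \<otimes> z" by (auto simp: lcos_eq_image)
        have "inv x \<otimes> k' = z" using z x sub by (simp add: m_assoc[symmetric] subset_iff)
        then show "k' \<in> {k. (k, x) \<in> ?Z}" using z x by simp
      qed
      moreover have "compactin (subtopology T K) ((x <# (C <#> D)) \<inter> K)"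
        using compactin_lcos[of x "C <#> D"] CD x sub KT
        by (auto simp: compactin_subtopology compact_Int_closedin)
      ultimately show ?thesis using K.haar_compact_sets[OF N] BK by (metis sets.Int)
    qed
    ultimately have "emeasure N (inv k <# D) \<le> emeasure N {k. (k, x) \<in> ?Z}"
      by (rule emeasure_mono)
    moreover have "emeasure N (inv k <# D) = emeasure N D"
      using K.haar_left_invariant[OF N _ K.haar_compact_sets[OF N DK], of "inv k"] kK
      by (simp add: l_coset_def)
    ultimately show "emeasure N D \<le> emeasure N {k. (k, x) \<in> ?Z}" by simp
  qed (use BK A Hausdorff Hausdorff_space_subtopology haar_sets[OF M] K.haar_sets[OF N] K.haar_compact_finite[OF N BK] in auto)
  then show ?thesis using posA by simp
qed

end

section \<open>Haar null sets of a \<sigma>-compact group\<close>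

context sigma_compact_group
begin

lemma compact_exhaustion:
  obtains Q :: "nat \<Rightarrow> 'a set" where "\<And>n. compactin T (Q n)" "(\<Union>n. Q n) = carrier G"
  using sigma_compact topspace_eq by (auto simp: sigma_compact_space_def)

text \<open>
  Outer regularity suffices: pass to a part of \<open>B\<close> inside a compact set \<open>Q\<close>, enclose the rest of \<open>Q\<close> in an open
  set of measure less than that of \<open>Q\<close>, and remove this open set from \<open>Q\<close>.
\<close>

lemma haar_positive_compact_subset:
  assumes M: "left_haar_measure G T M" and B: "B \<in> sets M" "emeasure M B \<noteq> 0"
  obtains C where "compactin T C" "C \<subseteq> B" "emeasure M C \<noteq> 0"
proof -
  obtain Q :: "nat \<Rightarrow> 'a set" where Q: "\<And>n. compactin T (Q n)" "(\<Union>n. Q n) = carrier G"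
    using compact_exhaustion by blast
  have QM: "Q n \<in> sets M" for n by (rule haar_compact_sets[OF M Q(1)])
  have "B = (\<Union>n. B \<inter> Q n)"
    using sets.sets_into_space[OF B(1)] haar_space[OF M] Q(2) by auto
  then obtain n where n: "emeasure M (B \<inter> Q n) \<noteq> 0"
    using emeasure_UN_eq_0[of M "\<lambda>n. B \<inter> Q n"] B QM by (metis image_subset_iff sets.Int)
  let ?P = "B \<inter> Q n"
  have P: "?P \<in> sets M" using B QM by auto
  have split: "emeasure M (Q n) = emeasure M (Q n - ?P) + emeasure M ?P"
  proof -
    have "(Q n - ?P) \<inter> ?P = {}" "(Q n - ?P) \<union> ?P = Q n" by blast+
    then show ?thesis
      using plus_emeasure[of "Q n - ?P" M ?P] P QM[of n] sets.Diff[OF QM[of n] P] by simp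
  qed
  have "emeasure M (Q n - ?P) < emeasure M (Q n)"
  proof (rule ccontr)
    assume "\<not> ?thesis"
    then have "emeasure M (Q n - ?P) + emeasure M ?P \<le> emeasure M (Q n - ?P)"
      using split by simp
    then have "emeasure M (Q n - ?P) + emeasure M ?P = emeasure M (Q n - ?P) + 0"
      by (simp add: antisym)
    moreover have "emeasure M (Q n - ?P) \<noteq> \<infinity>"
      using haar_compact_finite[OF M Q(1)[of n]] split by auto
    ultimately show False using n ennreal_add_left_cancel by metis
  qed
  moreover have "emeasure M (Q n - ?P) = (INF U \<in> {U. openin T U \<and> Q n - ?P \<subseteq> U}. emeasure M U)"
    using M P QM[of n] sets.Diff[of "Q n" M ?P] unfolding left_haar_measure_def by blast
  ultimately obtain U where U: "openin T U" "Q n - ?P \<subseteq> U" "emeasure M U < emeasure M (Q n)"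
    by (auto simp: INF_less_iff)
  have UM: "U \<in> sets M" by (rule open_in_borel_sets[OF haar_sets[OF M] U(1)])
  have "Q n - U = Q n \<inter> (topspace T - U)" using compactin_subset_topspace[OF Q(1)[of n]] by auto
  then have C: "compactin T (Q n - U)" using compact_Int_closedin[OF Q(1)[of n]] U(1) by (metis closedin_diff closedin_topspace)
  have "emeasure M (Q n - U) \<noteq> 0"
  proof
    assume 0: "emeasure M (Q n - U) = 0"
    have "emeasure M (Q n) \<le> emeasure M ((Q n - U) \<union> U)"
      using QM UM by (intro emeasure_mono) auto
    also have "\<dots> \<le> emeasure M (Q n - U) + emeasure M U"
      using QM UM by (intro emeasure_subadditive) auto
    finally show False using 0 U(3) by simp
  qed
  then show thesis using that[OF C] U(2) by blast
qed

lemma haar_null_sets_unique: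
  assumes M: "left_haar_measure G T M" and N: "left_haar_measure G T N"
  shows "null_sets M = null_sets N"
proof -
  have "null_sets M' \<subseteq> null_sets N'" if M': "left_haar_measure G T M'" and N': "left_haar_measure G T N'" for M' N'
  proof
    fix B assume B: "B \<in> null_sets M'"
    have "B \<in> sets N'" using B haar_sets[OF M'] haar_sets[OF N'] by auto
    moreover have "emeasure N' B = 0"
    proof (rule ccontr)
      assume "emeasure N' B \<noteq> 0"
      then obtain C where C: "compactin T C" "C \<subseteq> B" "emeasure N' C \<noteq> 0"
        using haar_positive_compact_subset[OF N' \<open>B \<in> sets N'\<close>] by blast
      then have "emeasure M' C = 0" using B emeasure_subset_null by (auto simp: null_sets_def)
      then show False using compact_null_unique[OF N' M' C(1)] C(3) by simp
    qed
    ultimately show "B \<in> null_sets N'" by auto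
  qed
  then show ?thesis using M N by blast
qed

lemma haar_null_sets_eq:
  assumes "left_haar_measure G T M"
  shows "haar_null_sets G T = {X. \<exists>B\<in>null_sets M. X \<subseteq> B}"
  unfolding haar_null_sets_def haar_null_sets_unique[OF haar_measure_left_haar assms] ..

text \<open>
  The right hand side speaks of compact sets only, to which the results on slices apply.
\<close>

lemma compact_UN_null_iff:
  assumes M: "left_haar_measure G T M" and C: "\<And>i. i \<in> I \<Longrightarrow> compactin T (C i)" and I: "countable I"
  shows "(\<Union>i\<in>I. C i) \<in> haar_null_sets G T \<longleftrightarrow> (\<forall>i\<in>I. emeasure M (C i) = 0)"
proof
  assume "(\<Union>i\<in>I. C i) \<in> haar_null_sets G T"
  then obtain B where B: "B \<in> null_sets M" "(\<Union>i\<in>I. C i) \<subseteq> B"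
    unfolding haar_null_sets_eq[OF M] by blast
  show "\<forall>i\<in>I. emeasure M (C i) = 0"
  proof
    fix i assume "i \<in> I"
    then have "C i \<subseteq> B" using B(2) by blast
    then show "emeasure M (C i) = 0" using emeasure_subset_null[of B M] B(1) by (auto simp: null_sets_def)
  qed
next
  assume "\<forall>i\<in>I. emeasure M (C i) = 0"
  then have "(\<Union>i\<in>I. C i) \<in> null_sets M"
    using haar_compact_sets[OF M C] I by (intro null_sets_UN') auto
  then show "(\<Union>i\<in>I. C i) \<in> haar_null_sets G T" unfolding haar_null_sets_eq[OF M] by blast
qed

lemma haar_null_sets_sigma_ideal: "set_sigma_ideal (carrier G) (haar_null_sets G T)"
proof -
  let ?M = "haar_measure G T"
  note M = haar_measure_left_haar
  have UN: "(\<Union>n. X n) \<in> haar_null_sets G T" if "\<And>n. X n \<in> haar_null_sets G T" for X :: "nat \<Rightarrow> 'a set"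
  proof -
    obtain B where "\<And>n. B n \<in> null_sets ?M" "\<And>n. X n \<subseteq> B n"
      using \<open>\<And>n. X n \<in> haar_null_sets G T\<close> unfolding haar_null_sets_def by (simp add: Bex_def) metis
    then show ?thesis
      unfolding haar_null_sets_def by (intro CollectI bexI[of _ "\<Union>n. B n"]) (auto intro: null_sets_UN)
  qed
  have Un: "X \<union> Y \<in> haar_null_sets G T" if X: "X \<in> haar_null_sets G T" and Y: "Y \<in> haar_null_sets G T" for X Y
  proof -
    obtain B where B: "B \<in> null_sets ?M" "X \<subseteq> B"
      using X unfolding haar_null_sets_def by blast
    obtain C where C: "C \<in> null_sets ?M" "Y \<subseteq> C"
      using Y unfolding haar_null_sets_def by blast
    have "B \<union> C \<in> null_sets ?M" using B C by auto
    moreover have "X \<union> Y \<subseteq> B \<union> C" using B C by auto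
    ultimately show ?thesis unfolding haar_null_sets_def by blast
  qed
  have "haar_null_sets G T \<subseteq> Pow (carrier G)"
    using haar_space[OF M] sets.sets_into_space[of _ ?M]
    by (fastforce simp: haar_null_sets_def null_sets_def)
  moreover have "{} \<in> haar_null_sets G T" unfolding haar_null_sets_def by auto
  moreover have "Y \<in> haar_null_sets G T" if "X \<in> haar_null_sets G T" "Y \<subseteq> X" for X Y
    using that by (auto simp: haar_null_sets_def)
  ultimately show ?thesis
    unfolding set_sigma_ideal_def set_ideal_def using UN Un by (simp add: Ball_def)
qed

section \<open>Dichotomy for closed subgroups\<close>

text \<open>
  If \<open>K\<close> has a compact subset \<open>C\<close> that is not null, then for each compact \<open>Q n\<close> of an exhaustion only finitely
  many cosets meet \<open>Q n\<close>, as they contain disjoint translates of \<open>C\<close> inside the compact set \<open>Q n C\<close>.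
\<close>

lemma subgroup_null_iff_uncountable_index:
  assumes K: "closed_subgroup G T K"
  shows "K \<in> haar_null_sets G T \<longleftrightarrow> uncountable (lcosets K)"
proof -
  define M where "M = haar_measure G T"
  have M: "left_haar_measure G T M" unfolding M_def by (rule haar_measure_left_haar)
  have KT: "closedin T K" and Ksub: "subgroup K G" using K by (auto simp: closed_subgroup_def)
  have KM: "K \<in> sets M" by (rule closed_in_borel_sets[OF haar_sets[OF M] KT])
  have null: "K \<in> haar_null_sets G T \<longleftrightarrow> emeasure M K = 0"
    unfolding haar_null_sets_eq[OF M] using KM emeasure_subset_null[of _ M K] by (auto simp: null_sets_def)
  have "emeasure M K \<noteq> 0" if countable: "countable (lcosets K)"
  proof
    assume 0: "emeasure M K = 0"
    have "c \<in> null_sets M" if "c \<in> lcosets K" for c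
      using that haar_lcos_sets[OF M _ KM] haar_left_invariant[OF M _ KM] 0 by (auto simp: LCOSETS_def)
    then have "(\<Union>c\<in>lcosets K. c) \<in> null_sets M" using countable by (intro null_sets_UN') auto
    moreover have "space M \<subseteq> (\<Union>c\<in>lcosets K. c)"
      using haar_space[OF M] lcos_self[OF _ Ksub] by (auto simp: LCOSETS_def)
    ultimately have "emeasure M (space M) = 0" using emeasure_subset_null by (auto simp: null_sets_def)
    then show False using M by (simp add: left_haar_measure_def)
  qed
  moreover have "countable (lcosets K)" if pos: "emeasure M K \<noteq> 0"
  proof -
    obtain C where C: "compactin T C" "C \<subseteq> K" "emeasure M C \<noteq> 0"
      using haar_positive_compact_subset[OF M KM pos] .
    have CM: "C \<in> sets M" by (rule haar_compact_sets[OF M C(1)])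
    obtain Q :: "nat \<Rightarrow> 'a set" where Q: "\<And>n. compactin T (Q n)" "(\<Union>n. Q n) = carrier G"
      using compact_exhaustion by blast
    have fin: "finite {c \<in> lcosets K. c \<inter> Q n \<noteq> {}}" for n
    proof -
      define b where "b = emeasure M (Q n <#> C)"
      have QC: "compactin T (Q n <#> C)" by (rule compactin_set_mult[OF Q(1) C(1)])
      have b: "b < \<infinity>" unfolding b_def by (rule haar_compact_finite[OF M QC])
      have bound: "of_nat (card F) * emeasure M C \<le> b"
        if F: "F \<subseteq> {c \<in> lcosets K. c \<inter> Q n \<noteq> {}}" "finite F" for F
      proof -
        have "\<forall>c\<in>F. \<exists>g. g \<in> c \<inter> Q n" using F by blast
        then obtain g where g: "\<And>c. c \<in> F \<Longrightarrow> g c \<in> c" "\<And>c. c \<in> F \<Longrightarrow> g c \<in> Q n" by (metis IntE)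
        have gG: "g c \<in> carrier G" if "c \<in> F" for c using g(2)[OF that] compact_subset_carrier[OF Q(1)] by blast
        have sub: "g c <# C \<subseteq> c" if c: "c \<in> F" for c
        proof -
          obtain a where a: "a \<in> carrier G" "c = a <# K" using F c by (auto simp: LCOSETS_def)
          have "c = g c <# K" using l_repr_independence[of "g c" a K] g(1)[OF c] a Ksub by simp
          then show ?thesis using C(2) by (auto simp: l_coset_def)
        qed
        have disj: "disjoint_family_on (\<lambda>c. g c <# C) F"
          unfolding disjoint_family_on_def
        proof (intro ballI impI)
          fix c d assume cd: "c \<in> F" "d \<in> F" "c \<noteq> d"
          have "c \<inter> d = {}"
            using lcos_disjoint[OF Ksub, of c d] F cd by blast
          then show "(g c <# C) \<inter> (g d <# C) = {}" using sub cd by blast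
        qed
        have "of_nat (card F) * emeasure M C = (\<Sum>c\<in>F. emeasure M (g c <# C))"
          using haar_left_invariant[OF M gG CM] by simp
        also have "\<dots> = emeasure M (\<Union>c\<in>F. g c <# C)"
          using disj F(2) haar_lcos_sets[OF M gG CM] by (intro sum_emeasure) auto
        also have "\<dots> \<le> b"
          unfolding b_def using haar_compact_sets[OF M QC] g(2)
          by (intro emeasure_mono) (auto simp: l_coset_def set_mult_def)
        finally show ?thesis .
      qed
      obtain N where N: "b / emeasure M C \<le> of_nat N"
      proof -
        have "b / emeasure M C < \<infinity>" using b C(3) by (simp add: ennreal_divide_eq_top_iff less_top[symmetric])
        then show thesis using that ennreal_Ex_less_of_nat less_imp_le by (metis infinity_ennreal_def)
      qed
      have "card F \<le> N" if F: "F \<subseteq> {c \<in> lcosets K. c \<inter> Q n \<noteq> {}}" "finite F" for F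
      proof -
        have fC: "emeasure M C < \<infinity>" by (rule haar_compact_finite[OF M C(1)])
        have "(of_nat (card F) :: ennreal) = of_nat (card F) * emeasure M C / emeasure M C"
          using C(3) fC by (simp add: ennreal_mult_divide_eq)
        also have "\<dots> \<le> b / emeasure M C" using bound[OF F] by (rule divide_right_mono_ennreal)
        also have "\<dots> \<le> of_nat N" by (rule N)
        finally show ?thesis by simp
      qed
      then show ?thesis using finite_if_finite_subsets_card_bdd by blast
    qed
    have "lcosets K \<subseteq> (\<Union>n. {c \<in> lcosets K. c \<inter> Q n \<noteq> {}})"
    proof
      fix c assume c: "c \<in> lcosets K"
      then obtain a where a: "a \<in> carrier G" "c = a <# K" by (auto simp: LCOSETS_def)
      then have "a \<in> c" using lcos_self[OF _ Ksub] by blast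
      moreover obtain n where "a \<in> Q n" using a Q(2) by blast
      ultimately show "c \<in> (\<Union>n. {c \<in> lcosets K. c \<inter> Q n \<noteq> {}})" using c by blast
    qed
    moreover have "countable (\<Union>n. {c \<in> lcosets K. c \<inter> Q n \<noteq> {}})"
      using fin by (intro countable_UN) (auto intro: countable_finite)
    ultimately show ?thesis by (rule countable_subset)
  qed
  ultimately show ?thesis using null by blast
qed

section \<open>Transitivity\<close>

lemma closed_subgroup_exhaustion:
  assumes H: "closed_subgroup G T H"
  obtains Q :: "nat \<Rightarrow> 'a set" where "\<And>n. compactin T (Q n)" "(\<Union>n. Q n) = H"
proof -
  obtain Q :: "nat \<Rightarrow> 'a set" where Q: "\<And>n. compactin T (Q n)" "(\<Union>n. Q n) = carrier G"
    using compact_exhaustion by blast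
  have "compactin T (Q n \<inter> H)" for n
    using Q(1) H by (simp add: compact_Int_closedin closed_subgroup_def)
  moreover have "(\<Union>n. Q n \<inter> H) = H" using Q(2) H subgroup.subset by (auto simp: closed_subgroup_def)
  ultimately show thesis using that[of "\<lambda>n. Q n \<inter> H"] by blast
qed

lemma set_mult_null_iff:
  fixes R S :: "nat \<Rightarrow> 'a set"
  assumes M: "left_haar_measure G T M" and R: "\<And>n. compactin T (R n)" and S: "\<And>n. compactin T (S n)"
  shows "(\<Union>n. R n) <#> (\<Union>n. S n) \<in> haar_null_sets G T \<longleftrightarrow> (\<forall>m n. emeasure M (R m <#> S n) = 0)"
proof -
  have "(\<Union>n. R n) <#> (\<Union>n. S n) = (\<Union>(m, n)\<in>UNIV. R m <#> S n)"
    by (auto simp: set_mult_def)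
  moreover have "(\<Union>(m, n)\<in>UNIV. R m <#> S n) \<in> haar_null_sets G T
      \<longleftrightarrow> (\<forall>(m, n)\<in>UNIV. emeasure M (R m <#> S n) = 0)"
    using compact_UN_null_iff[OF M, of UNIV "\<lambda>(m, n). R m <#> S n"] compactin_set_mult R S
    by (simp add: split_def)
  ultimately show ?thesis by simp
qed

text \<open>
  All products are exhausted by products of compact sets. If \<open>H P\<close> is null and \<open>H K\<close> is not,
  \<open>null_on_subgroup_if_product_null\<close> shows that the compact pieces of \<open>(H \<inter> K) P\<close> are null. Conversely, if
  \<open>(H \<inter> K) P\<close> is null in \<open>K\<close>, then so is \<open>x C \<inter> K\<close> for every compact piece \<open>C\<close> of \<open>H P\<close>, and
  \<open>inverse_null_if_translates_null_on_subgroup\<close> applies.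
\<close>

lemma haar_transitivity:
  assumes K: "closed_subgroup G T K" and P: "closed_subgroup G T P" and H: "closed_subgroup G T H"
    and PK: "P \<subseteq> K"
  shows "H <#> P \<in> haar_null_sets G T \<longleftrightarrow>
    H <#> K \<in> haar_null_sets G T \<or> (H \<inter> K) <#> P \<in> haar_scheme G T K"
proof -
  let ?GK = "G\<lparr>carrier := K\<rparr>" and ?TK = "subtopology T K"
  interpret K: sigma_compact_group ?GK ?TK
    by (rule closed_subgroup_sigma_compact_group[OF sigma_compact_group_axioms K])
  define M where "M = haar_measure G T"
  define N where "N = haar_measure ?GK ?TK"
  have M: "left_haar_measure G T M" unfolding M_def by (rule haar_measure_left_haar)
  have N: "left_haar_measure ?GK ?TK N" unfolding N_def by (rule K.haar_measure_left_haar)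
  have Ksub: "subgroup K G" and Hsub: "subgroup H G" and Psub: "subgroup P G"
    and KT: "closedin T K"
    using K H P by (auto simp: closed_subgroup_def)
  note G = subgroup.subset[OF Ksub] subgroup.subset[OF Hsub] subgroup.subset[OF Psub]
  obtain HQ :: "nat \<Rightarrow> 'a set" where HQ: "\<And>n. compactin T (HQ n)" "(\<Union>n. HQ n) = H"
    using closed_subgroup_exhaustion[OF H] by blast
  obtain KQ :: "nat \<Rightarrow> 'a set" where KQ: "\<And>n. compactin T (KQ n)" "(\<Union>n. KQ n) = K"
    using closed_subgroup_exhaustion[OF K] by blast
  obtain PQ :: "nat \<Rightarrow> 'a set" where PQ: "\<And>n. compactin T (PQ n)" "(\<Union>n. PQ n) = P"
    using closed_subgroup_exhaustion[OF P] by blast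
  define JQ where "JQ n = HQ n \<inter> K" for n
  have JQ: "\<And>n. compactin T (JQ n)" "(\<Union>n. JQ n) = H \<inter> K" "\<And>n. JQ n \<subseteq> K" "\<And>n. JQ n \<subseteq> HQ n"
    using HQ KT by (auto simp: JQ_def compact_Int_closedin)
  have sub: "HQ n \<subseteq> H" "JQ n \<subseteq> H" "PQ n \<subseteq> P" "KQ n \<subseteq> K" for n
    using HQ(2) PQ(2) KQ(2) JQ(4) by blast+
  have PQK: "PQ n \<subseteq> K" for n using PQ(2) PK by blast
  have HP: "H <#> P \<in> haar_null_sets G T \<longleftrightarrow> (\<forall>m n. emeasure M (HQ m <#> PQ n) = 0)"
    using set_mult_null_iff[OF M, of HQ PQ, OF HQ(1) PQ(1)] HQ(2) PQ(2) by simp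
  have HK: "H <#> K \<in> haar_null_sets G T \<longleftrightarrow> (\<forall>m n. emeasure M (HQ m <#> KQ n) = 0)"
    using set_mult_null_iff[OF M, of HQ KQ, OF HQ(1) KQ(1)] HQ(2) KQ(2) by simp
  have mult: "X <#>\<^bsub>?GK\<^esub> Y = X <#> Y" for X Y by (simp add: set_mult_def)
  have JP: "(H \<inter> K) <#> P \<in> haar_scheme G T K \<longleftrightarrow> (\<forall>m n. emeasure N (JQ m <#> PQ n) = 0)"
    using K.set_mult_null_iff[OF N, of JQ PQ] JQ PQ PQK
    by (simp only: compactin_subtopology haar_scheme_def mult)
  have HP_HK: "H <#> P \<subseteq> H <#> K" using PK by (auto simp: set_mult_def)
  show ?thesis
  proof
    assume null: "H <#> P \<in> haar_null_sets G T"
    show "H <#> K \<in> haar_null_sets G T \<or> (H \<inter> K) <#> P \<in> haar_scheme G T K"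
    proof (rule disjCI)
      assume notJP: "(H \<inter> K) <#> P \<notin> haar_scheme G T K"
      then obtain i j where ij: "emeasure N (JQ i <#> PQ j) \<noteq> 0" using JP by blast
      let ?D = "JQ i <#> PQ j"
      have D: "compactin T ?D" by (rule compactin_set_mult[OF JQ(1) PQ(1)])
      have DK: "?D \<subseteq> K"
        using JQ(3)[of i] PQK[of j] subgroup.m_closed[OF Ksub] by (auto simp: set_mult_def subset_iff)
      show "H <#> K \<in> haar_null_sets G T"
        unfolding HK
      proof (intro allI, rule ccontr)
        fix m n assume pos: "emeasure M (HQ m <#> KQ n) \<noteq> 0"
        have "HQ m <#> ?D \<subseteq> H <#> P"
        proof
          fix x assume "x \<in> HQ m <#> ?D"
          then obtain h j p where "h \<in> H" "j \<in> H" "p \<in> P" "x = h \<otimes> (j \<otimes> p)"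
            using sub unfolding set_mult_def by blast
          then have "x = (h \<otimes> j) \<otimes> p" "h \<otimes> j \<in> H"
            using G subgroup.m_closed[OF Hsub] by (auto simp: m_assoc subset_iff)
          then show "x \<in> H <#> P" using \<open>p \<in> P\<close> unfolding set_mult_def by blast
        qed
        moreover obtain B where "B \<in> null_sets M" "H <#> P \<subseteq> B"
          using null unfolding haar_null_sets_eq[OF M] by blast
        ultimately have "emeasure M (HQ m <#> ?D) = 0"
          using emeasure_subset_null[of B M] by (auto simp: null_sets_def)
        then have "emeasure N ?D = 0"
          by (rule null_on_subgroup_if_product_null[OF K M N HQ(1) D DK KQ(1) sub(4) _ pos])
        then show False using ij by simp
      qed
    qed
  next
    assume "H <#> K \<in> haar_null_sets G T \<or> (H \<inter> K) <#> P \<in> haar_scheme G T K"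
    then show "H <#> P \<in> haar_null_sets G T"
    proof
      assume "H <#> K \<in> haar_null_sets G T"
      then show ?thesis using HP_HK unfolding haar_null_sets_def by blast
    next
      assume null: "(H \<inter> K) <#> P \<in> haar_scheme G T K"
      then obtain B where B: "B \<in> null_sets N" "(H \<inter> K) <#> P \<subseteq> B"
        unfolding haar_scheme_def K.haar_null_sets_eq[OF N] by blast
      show ?thesis
        unfolding HP
      proof (intro allI)
        fix m n
        let ?C = "HQ m <#> PQ n"
        have C: "compactin T ?C" by (rule compactin_set_mult[OF HQ(1) PQ(1)])
        have slice: "emeasure N ((x <# ?C) \<inter> K) = 0" if x: "x \<in> carrier G" for x
        proof (cases "(x <# ?C) \<inter> K = {}")
          case False
          then obtain h p where hp: "h \<in> H" "p \<in> P" "x \<otimes> (h \<otimes> p) \<in> K"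
            using sub unfolding l_coset_def set_mult_def by blast
          \<comment> \<open>One point of the slice fixes the translation that carries the whole slice into \<open>(H \<inter> K) P\<close>.\<close>
          define k where "k = x \<otimes> h"
          have hG: "h \<in> carrier G" "p \<in> carrier G" "p \<in> K" using hp G PK by auto
          have "k = (x \<otimes> (h \<otimes> p)) \<otimes> inv p" using x hG by (simp add: k_def m_assoc)
          then have k: "k \<in> K" using hp hG subgroup.m_closed[OF Ksub] subgroup.m_inv_closed[OF Ksub] by simp
          have "(x <# ?C) \<inter> K \<subseteq> k <#\<^bsub>?GK\<^esub> B"
          proof
            fix y assume "y \<in> (x <# ?C) \<inter> K"
            then obtain h' p' where y: "y \<in> K" "h' \<in> H" "p' \<in> P" "y = x \<otimes> (h' \<otimes> p')"
              using sub unfolding l_coset_def set_mult_def by blast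
            have G': "h' \<in> carrier G" "p' \<in> carrier G" "p' \<in> K" "y \<in> carrier G" using y G PK by auto
            have "inv h \<otimes> h' = inv k \<otimes> (y \<otimes> inv p')"
              using x hG G' by (simp add: k_def y(4) inv_mult_group m_assoc) (simp add: m_assoc[symmetric])
            moreover have "inv k \<otimes> (y \<otimes> inv p') \<in> K"
              using k y G' subgroup.m_closed[OF Ksub] subgroup.m_inv_closed[OF Ksub] by simp
            moreover have "inv h \<otimes> h' \<in> H"
              using hp y subgroup.m_closed[OF Hsub] subgroup.m_inv_closed[OF Hsub] by simp
            ultimately have "(inv h \<otimes> h') \<otimes> p' \<in> (H \<inter> K) <#> P" using y unfolding set_mult_def by auto
            then have "(inv h \<otimes> h') \<otimes> p' \<in> B" using B(2) by blast
            moreover have "y = k \<otimes> ((inv h \<otimes> h') \<otimes> p')"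
              using x hG G' by (simp add: k_def y(4) m_assoc) (simp add: m_assoc[symmetric])
            ultimately show "y \<in> k <#\<^bsub>?GK\<^esub> B" unfolding l_coset_def by auto
          qed
          note cover = this
          have "k \<in> carrier ?GK" "B \<in> sets N" "emeasure N B = 0" using k B(1) by auto
          then have "k <#\<^bsub>?GK\<^esub> B \<in> sets N" "emeasure N (k <#\<^bsub>?GK\<^esub> B) = 0"
            using K.haar_lcos_sets[OF N, of k B] K.haar_left_invariant[OF N, of k B] by simp_all
          then show ?thesis by (rule emeasure_subset_null[OF _ _ cover])
        qed simp
        have "emeasure M ((\<lambda>x. inv x) ` ?C) = 0"
          by (rule inverse_null_if_translates_null_on_subgroup[OF K M N C slice])
        then show "emeasure M ?C = 0" by (simp add: inverse_null_iff[OF M C])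
      qed
    qed
  qed
qed

end

section \<open>Invariance\<close>

text \<open>
  Equivariance is required only in the form that left translates of images are images of left
  translates, in order to cover right translations as well as conjugations.
\<close>

lemma left_haar_measure_distr:
  fixes G (structure) and G' :: "('b, 'd) monoid_scheme"
  assumes M: "left_haar_measure G T M" and TG: "topspace T = carrier G"
    and lcos: "\<forall>g\<in>carrier G. \<forall>B\<in>sets M. g <# B \<in> sets M"
    and \<phi>: "homeomorphic_map T T' \<phi>"
    and equivariant: "\<forall>g' \<in> carrier G'. \<forall>B \<subseteq> carrier G.
      \<exists>g \<in> carrier G. g' <#\<^bsub>G'\<^esub> (\<phi> ` B) = \<phi> ` (g <# B)"
  defines "N \<equiv> distr M (sigma (topspace T') {U. openin T' U}) \<phi>"
  shows "left_haar_measure G' T' N"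
    and "B \<in> sets M \<Longrightarrow> \<phi> ` B \<in> sets N \<and> emeasure N (\<phi> ` B) = emeasure M B"
    and "B' \<in> sets N \<Longrightarrow> \<exists>B \<in> sets M. B' = \<phi> ` B"
proof -
  have Ms: "sets M = sets (sigma (topspace T) {U. openin T U})"
    using M by (simp add: left_haar_measure_def)
  have Mnz: "emeasure M (space M) \<noteq> 0"
    and Minv: "\<And>g B. g \<in> carrier G \<Longrightarrow> B \<in> sets M \<Longrightarrow> emeasure M (g <# B) = emeasure M B"
    and Mfin: "\<And>K. compactin T K \<Longrightarrow> emeasure M K < \<infinity>"
    and Mout: "\<And>B. B \<in> sets M \<Longrightarrow> emeasure M B = (INF U \<in> {U. openin T U \<and> B \<subseteq> U}. emeasure M U)"
    and Minn: "\<And>U. openin T U \<Longrightarrow> emeasure M U = (SUP K \<in> {K. compactin T K \<and> K \<subseteq> U}. emeasure M K)"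
    using M unfolding left_haar_measure_def by blast+
  have Ns: "sets N = sets (sigma (topspace T') {U. openin T' U})"
    unfolding N_def by simp
  have sp: "space M = topspace T" "space N = topspace T'"
    using space_of_borel_sets[OF Ms] space_of_borel_sets[OF Ns] by auto
  have inj: "inj_on \<phi> (topspace T)" and surj: "\<phi> ` topspace T = topspace T'"
    using \<phi> homeomorphic_imp_injective_map homeomorphic_imp_surjective_map by blast+
  have pre: "S = \<phi> ` {x \<in> topspace T. \<phi> x \<in> S}" if "S \<subseteq> topspace T'" for S
    using that unfolding surj[symmetric] by blast
  have meas: "\<phi> \<in> measurable M (sigma (topspace T') {U. openin T' U})"
    by (rule continuous_map_measurable[OF homeomorphic_imp_continuous_map[OF \<phi>] Ms refl])
  have em: "\<phi> ` B \<in> sets N \<and> emeasure N (\<phi> ` B) = emeasure M B" if B: "B \<in> sets M" for B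
  proof -
    have B': "\<phi> ` B \<in> sets N" by (rule homeomorphic_image_borel[OF \<phi> Ms Ns B])
    have "B \<subseteq> topspace T" using sets.sets_into_space[OF B] sp by simp
    then have "\<phi> -` (\<phi> ` B) \<inter> space M = B"
      unfolding sp(1) using inj_on_image_mem_iff[OF inj] by blast
    then show ?thesis using B' emeasure_distr[OF meas, of "\<phi> ` B"] unfolding N_def by simp
  qed
  have onto: "\<exists>B \<in> sets M. B' = \<phi> ` B" if B': "B' \<in> sets N" for B'
  proof
    have "{x \<in> topspace T. \<phi> x \<in> B'} = \<phi> -` B' \<inter> space M" using sp by auto
    then show "{x \<in> topspace T. \<phi> x \<in> B'} \<in> sets M"
      using measurable_sets[OF meas] B' Ns by simp
    show "B' = \<phi> ` {x \<in> topspace T. \<phi> x \<in> B'}"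
      using sets.sets_into_space[OF B'] sp by (intro pre) simp
  qed
  have opens: "\<exists>U. openin T U \<and> U' = \<phi> ` U" if "openin T' U'" for U'
  proof -
    have "U' \<subseteq> topspace T'" using openin_subset[OF that] .
    then have "U' = \<phi> ` {x \<in> topspace T. \<phi> x \<in> U'}" by (rule pre)
    then show ?thesis
      using openin_continuous_map_preimage[OF homeomorphic_imp_continuous_map[OF \<phi>] that] by blast
  qed
  have open_img: "openin T' (\<phi> ` U)" if "openin T U" for U
    using homeomorphic_map_openness_eq[OF \<phi>] that by blast
  have compacts: "\<exists>K. compactin T K \<and> K' = \<phi> ` K" if "compactin T' K'" for K'
  proof -
    have "K' \<subseteq> topspace T'" using compactin_subset_topspace[OF that] .
    then have *: "K' = \<phi> ` {x \<in> topspace T. \<phi> x \<in> K'}" by (rule pre)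
    then have "compactin T {x \<in> topspace T. \<phi> x \<in> K'}"
      using that homeomorphic_map_compactness_eq[OF \<phi>, of "{x \<in> topspace T. \<phi> x \<in> K'}"] by simp
    then show ?thesis using * by blast
  qed
  have compact_img: "compactin T' (\<phi> ` K)" if "compactin T K" for K
    using homeomorphic_map_compactness_eq[OF \<phi>] that by blast
  have emU: "emeasure N (\<phi> ` U) = emeasure M U" if "openin T U" for U
    using em open_in_borel_sets[OF Ms that] by blast
  have emK: "emeasure N (\<phi> ` K) = emeasure M K" if K: "K \<subseteq> topspace T" for K
  proof (cases "K \<in> sets M")
    case False
    have "\<phi> ` K \<notin> sets N"
    proof
      assume "\<phi> ` K \<in> sets N"
      then obtain B where B: "B \<in> sets M" "\<phi> ` K = \<phi> ` B" using onto by blast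
      then have "K = B"
        using inj_on_image_eq_iff[OF inj K] sets.sets_into_space[OF B(1)] sp by simp
      then show False using B False by simp
    qed
    then show ?thesis using False by (simp add: emeasure_notin_sets)
  qed (use em in blast)
  show "left_haar_measure G' T' N"
    unfolding left_haar_measure_def
  proof (intro conjI ballI allI impI)
    show "sets N = sets (sigma (topspace T') {U. openin T' U})" by (rule Ns)
    show "emeasure N (space N) \<noteq> 0"
      using em[OF sets.top[of M]] sp surj Mnz by simp
    fix g' B' assume g': "g' \<in> carrier G'" and "B' \<in> sets N"
    then obtain B where B: "B \<in> sets M" "B' = \<phi> ` B" using onto by blast
    have "B \<subseteq> carrier G" using sets.sets_into_space[OF B(1)] sp TG by simp
    then obtain g where g: "g \<in> carrier G" "g' <#\<^bsub>G'\<^esub> B' = \<phi> ` (g <# B)"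
      using equivariant g' B by blast
    then have "emeasure N (g' <#\<^bsub>G'\<^esub> B') = emeasure M (g <# B)"
      using em lcos B by simp
    also have "\<dots> = emeasure M B" by (rule Minv[OF g(1) B(1)])
    finally show "emeasure N (g' <#\<^bsub>G'\<^esub> B') = emeasure N B'" using em B by simp
  next
    fix K' assume "compactin T' K'"
    then obtain K where K: "compactin T K" "K' = \<phi> ` K" using compacts by blast
    then show "emeasure N K' < \<infinity>"
      using emK[OF compactin_subset_topspace[OF K(1)]] Mfin[OF K(1)] by simp
  next
    fix B' assume B': "B' \<in> sets N"
    then obtain B where B: "B \<in> sets M" "B' = \<phi> ` B" using onto by blast
    show "emeasure N B' = (INF U \<in> {U. openin T' U \<and> B' \<subseteq> U}. emeasure N U)"
    proof (rule antisym)
      show "emeasure N B' \<le> (INF U \<in> {U. openin T' U \<and> B' \<subseteq> U}. emeasure N U)"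
        by (intro INF_greatest emeasure_mono) (auto intro: open_in_borel_sets[OF Ns])
      have "emeasure N B' = (INF U \<in> {U. openin T U \<and> B \<subseteq> U}. emeasure M U)"
        using em[OF B(1)] B(2) Mout[OF B(1)] by simp
      moreover have "(INF U \<in> {U. openin T' U \<and> B' \<subseteq> U}. emeasure N U)
          \<le> (INF U \<in> {U. openin T U \<and> B \<subseteq> U}. emeasure M U)"
      proof (rule INF_mono)
        fix U assume U: "U \<in> {U. openin T U \<and> B \<subseteq> U}"
        then have "\<phi> ` U \<in> {U. openin T' U \<and> B' \<subseteq> U}" using open_img B(2) by blast
        moreover have "emeasure N (\<phi> ` U) \<le> emeasure M U" using U emU by simp
        ultimately show "\<exists>V\<in>{U. openin T' U \<and> B' \<subseteq> U}. emeasure N V \<le> emeasure M U" by blast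
      qed
      ultimately show "(INF U \<in> {U. openin T' U \<and> B' \<subseteq> U}. emeasure N U) \<le> emeasure N B'" by simp
    qed
  next
    fix U' assume U': "openin T' U'"
    then obtain U where U: "openin T U" "U' = \<phi> ` U" using opens by blast
    show "emeasure N U' = (SUP K \<in> {K. compactin T' K \<and> K \<subseteq> U'}. emeasure N K)"
    proof (rule antisym)
      show "(SUP K \<in> {K. compactin T' K \<and> K \<subseteq> U'}. emeasure N K) \<le> emeasure N U'"
        using open_in_borel_sets[OF Ns U'] by (intro SUP_least emeasure_mono) auto
      have "emeasure N U' = (SUP K \<in> {K. compactin T K \<and> K \<subseteq> U}. emeasure M K)"
        using emU[OF U(1)] U(2) Minn[OF U(1)] by simp
      moreover have "(SUP K \<in> {K. compactin T K \<and> K \<subseteq> U}. emeasure M K)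
          \<le> (SUP K \<in> {K. compactin T' K \<and> K \<subseteq> U'}. emeasure N K)"
      proof (rule SUP_mono)
        fix K assume K: "K \<in> {K. compactin T K \<and> K \<subseteq> U}"
        then have "\<phi> ` K \<in> {K. compactin T' K \<and> K \<subseteq> U'}" using compact_img U(2) by blast
        moreover have "emeasure M K \<le> emeasure N (\<phi> ` K)"
          using K emK[of K] compactin_subset_topspace[of T K] by simp
        ultimately show "\<exists>L\<in>{K. compactin T' K \<and> K \<subseteq> U'}. emeasure M K \<le> emeasure N L" by blast
      qed
      ultimately show "emeasure N U' \<le> (SUP K \<in> {K. compactin T' K \<and> K \<subseteq> U'}. emeasure N K)" by simp
    qed
  qed
  show "B \<in> sets M \<Longrightarrow> \<phi> ` B \<in> sets N \<and> emeasure N (\<phi> ` B) = emeasure M B" by (rule em)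
  show "B' \<in> sets N \<Longrightarrow> \<exists>B \<in> sets M. B' = \<phi> ` B" by (rule onto)
qed

text \<open>
  The image of a left Haar measure under \<open>\<phi>\<close> is a left Haar measure, and the null sets do not depend on
  which left Haar measure is used.
\<close>

lemma haar_null_sets_transport:
  fixes G (structure) and G' :: "('b, 'd) monoid_scheme"
  assumes "sigma_compact_group G T" and "sigma_compact_group G' T'"
    and \<phi>: "homeomorphic_map T T' \<phi>"
    and equivariant: "\<forall>g' \<in> carrier G'. \<forall>B \<subseteq> carrier G.
      \<exists>g \<in> carrier G. g' <#\<^bsub>G'\<^esub> (\<phi> ` B) = \<phi> ` (g <# B)"
  shows "haar_null_sets G' T' = (\<lambda>X. \<phi> ` X) ` haar_null_sets G T"
proof -
  interpret sigma_compact_group G T by fact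
  interpret G': sigma_compact_group G' T' by fact
  define M where "M = haar_measure G T"
  have M: "left_haar_measure G T M" unfolding M_def by (rule haar_measure_left_haar)
  define N where "N = distr M (sigma (topspace T') {U. openin T' U}) \<phi>"
  have lcos: "\<forall>g\<in>carrier G. \<forall>B\<in>sets M. g <# B \<in> sets M" using haar_lcos_sets[OF M] by blast
  note N = left_haar_measure_distr[OF M topspace_eq lcos \<phi> equivariant, folded N_def]
  have eq: "haar_null_sets G T = {X. \<exists>B\<in>null_sets M. X \<subseteq> B}" by (rule haar_null_sets_eq[OF M])
  have eq': "haar_null_sets G' T' = {X. \<exists>B\<in>null_sets N. X \<subseteq> B}" by (rule G'.haar_null_sets_eq[OF N(1)])
  show ?thesis
  proof (intro equalityI subsetI)
    fix X' assume "X' \<in> haar_null_sets G' T'"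
    then obtain B' where B': "B' \<in> null_sets N" "X' \<subseteq> B'" unfolding eq' by blast
    then obtain B where B: "B \<in> sets M" "B' = \<phi> ` B" using N(3)[of B'] by blast
    then have "B \<in> null_sets M" using N(2)[OF B(1)] B'(1) by (auto simp: null_sets_def)
    moreover have "X' = \<phi> ` {x \<in> B. \<phi> x \<in> X'}" using B'(2) B(2) by auto
    ultimately show "X' \<in> (\<lambda>X. \<phi> ` X) ` haar_null_sets G T" unfolding eq by blast
  next
    fix X' assume "X' \<in> (\<lambda>X. \<phi> ` X) ` haar_null_sets G T"
    then obtain X B where "X' = \<phi> ` X" "B \<in> null_sets M" "X \<subseteq> B" unfolding eq by blast
    moreover from this have "\<phi> ` B \<in> null_sets N" using N(2)[of B] by (auto simp: null_sets_def)
    ultimately show "X' \<in> haar_null_sets G' T'" unfolding eq' by blast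
  qed
qed

context sigma_compact_group
begin

lemma haar_null_lcos:
  assumes h: "h \<in> carrier G" and X: "X \<in> haar_null_sets G T"
  shows "h <# X \<in> haar_null_sets G T"
proof -
  note M = haar_measure_left_haar
  obtain B where B: "B \<in> null_sets (haar_measure G T)" "X \<subseteq> B" using X unfolding haar_null_sets_def by blast
  then have "h <# B \<in> null_sets (haar_measure G T)"
    using haar_lcos_sets[OF M h] haar_left_invariant[OF M h] by (auto simp: null_sets_def)
  moreover have "h <# X \<subseteq> h <# B" using B(2) by (auto simp: l_coset_def)
  ultimately show ?thesis unfolding haar_null_sets_def by blast
qed

lemma homeomorphic_map_right_mult:
  assumes "g \<in> carrier G" shows "homeomorphic_map T T (\<lambda>x. x \<otimes> g)"
proof -
  have "homeomorphic_maps T T (\<lambda>x. x \<otimes> g) (\<lambda>x. x \<otimes> inv g)"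
    unfolding homeomorphic_maps_def using assms
    by (auto simp: topspace_eq m_assoc
        intro!: continuous_map_group_mult continuous_map_group_const continuous_map_id[unfolded id_def])
  then show ?thesis using homeomorphic_maps_map by blast
qed

lemma haar_null_rcos:
  assumes h: "h \<in> carrier G" and X: "X \<in> haar_null_sets G T"
  shows "X #> h \<in> haar_null_sets G T"
proof -
  have "haar_null_sets G T = (\<lambda>X. (\<lambda>x. x \<otimes> h) ` X) ` haar_null_sets G T"
  proof (rule haar_null_sets_transport[OF sigma_compact_group_axioms sigma_compact_group_axioms])
    show "homeomorphic_map T T (\<lambda>x. x \<otimes> h)" by (rule homeomorphic_map_right_mult[OF h])
    show "\<forall>g\<in>carrier G. \<forall>B\<subseteq>carrier G. \<exists>k\<in>carrier G. g <# ((\<lambda>x. x \<otimes> h) ` B) = (\<lambda>x. x \<otimes> h) ` (k <# B)"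
    proof (intro ballI allI impI)
      fix g B assume g: "g \<in> carrier G" and B: "B \<subseteq> carrier G"
      have "g <# ((\<lambda>x. x \<otimes> h) ` B) = (\<lambda>x. x \<otimes> h) ` (g <# B)"
        unfolding lcos_eq_image image_image
        using g B h by (intro image_cong refl) (auto simp: m_assoc)
      then show "\<exists>k\<in>carrier G. g <# ((\<lambda>x. x \<otimes> h) ` B) = (\<lambda>x. x \<otimes> h) ` (k <# B)" using g by blast
    qed
  qed
  moreover have "X #> h = (\<lambda>x. x \<otimes> h) ` X" by (auto simp: r_coset_def)
  ultimately show ?thesis using X by blast
qed

lemma haar_scheme_conjugate:
  assumes H: "closed_subgroup G T H" and g: "g \<in> carrier G"
  shows "{inv g <# X #> g | X. X \<in> haar_scheme G T H} = haar_scheme G T (inv g <# H #> g)"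
proof -
  define \<phi> where "\<phi> x = inv g \<otimes> x \<otimes> g" for x
  have Hsub: "subgroup H G" and HT: "closedin T H" using H by (auto simp: closed_subgroup_def)
  have HG: "H \<subseteq> carrier G" by (rule subgroup.subset[OF Hsub])
  have img: "inv g <# X #> g = \<phi> ` X" for X by (auto simp: \<phi>_def l_coset_def r_coset_def)
  have \<phi>_homeo: "homeomorphic_map T T \<phi>"
    using homeomorphic_map_compose[OF homeomorphic_map_left_mult[OF inv_closed[OF g]] homeomorphic_map_right_mult[OF g]]
    by (simp add: o_def \<phi>_def[abs_def])
  have mult: "\<phi> (x \<otimes> y) = \<phi> x \<otimes> \<phi> y" if "x \<in> carrier G" "y \<in> carrier G" for x y
  proof -
    have "g \<otimes> (inv g \<otimes> (y \<otimes> g)) = y \<otimes> g" using that g by (simp add: m_assoc[symmetric])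
    then show ?thesis using that g by (simp add: \<phi>_def m_assoc)
  qed
  have \<phi>_inv: "\<phi> (inv x) = inv (\<phi> x)" if "x \<in> carrier G" for x
    using that g by (simp add: \<phi>_def inv_mult_group m_assoc)
  have \<phi>G: "\<phi> x \<in> carrier G" if "x \<in> carrier G" for x using that g by (simp add: \<phi>_def)
  have sub': "subgroup (\<phi> ` H) G"
  proof (rule subgroupI)
    show "\<phi> ` H \<subseteq> carrier G" using HG \<phi>G by blast
    show "\<phi> ` H \<noteq> {}" using subgroup.one_closed[OF Hsub] by blast
    fix a assume "a \<in> \<phi> ` H"
    then obtain x where x: "x \<in> H" "a = \<phi> x" by blast
    have xG: "x \<in> carrier G" using x(1) HG by (rule subsetD[rotated])
    have "inv a = \<phi> (inv x)" unfolding x(2) by (rule \<phi>_inv[OF xG, symmetric])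
    then show "inv a \<in> \<phi> ` H" using subgroup.m_inv_closed[OF Hsub x(1)] by simp
    fix b assume "b \<in> \<phi> ` H"
    then obtain y where y: "y \<in> H" "b = \<phi> y" by blast
    have yG: "y \<in> carrier G" using y(1) HG by (rule subsetD[rotated])
    have "a \<otimes> b = \<phi> (x \<otimes> y)" unfolding x(2) y(2) by (rule mult[OF xG yG, symmetric])
    then show "a \<otimes> b \<in> \<phi> ` H" using subgroup.m_closed[OF Hsub x(1) y(1)] by simp
  qed
  have cl': "closed_subgroup G T (\<phi> ` H)"
    using sub' HT homeomorphic_map_closedness_eq[OF \<phi>_homeo, of H] by (simp add: closed_subgroup_def)
  have "haar_null_sets (G\<lparr>carrier := \<phi> ` H\<rparr>) (subtopology T (\<phi> ` H))
      = (\<lambda>X. \<phi> ` X) ` haar_null_sets (G\<lparr>carrier := H\<rparr>) (subtopology T H)"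
  proof (rule haar_null_sets_transport)
    show "sigma_compact_group (G\<lparr>carrier := H\<rparr>) (subtopology T H)"
      by (rule closed_subgroup_sigma_compact_group[OF sigma_compact_group_axioms H])
    show "sigma_compact_group (G\<lparr>carrier := \<phi> ` H\<rparr>) (subtopology T (\<phi> ` H))"
      by (rule closed_subgroup_sigma_compact_group[OF sigma_compact_group_axioms cl'])
    show "homeomorphic_map (subtopology T H) (subtopology T (\<phi> ` H)) \<phi>"
    proof (rule homeomorphic_map_subtopologies[OF \<phi>_homeo])
      have "\<phi> ` H \<subseteq> carrier G" by (rule subgroup.subset[OF sub'])
      then show "\<phi> ` (topspace T \<inter> H) = topspace T \<inter> \<phi> ` H"
        using HG by (simp add: topspace_eq Int_absorb1)
    qed
    show "\<forall>k\<in>carrier (G\<lparr>carrier := \<phi> ` H\<rparr>). \<forall>B\<subseteq>carrier (G\<lparr>carrier := H\<rparr>). \<exists>h\<in>carrier (G\<lparr>carrier := H\<rparr>).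
        k <#\<^bsub>G\<lparr>carrier := \<phi> ` H\<rparr>\<^esub> (\<phi> ` B) = \<phi> ` (h <#\<^bsub>G\<lparr>carrier := H\<rparr>\<^esub> B)"
    proof (intro ballI allI impI)
      fix k B assume k: "k \<in> carrier (G\<lparr>carrier := \<phi> ` H\<rparr>)" and B: "B \<subseteq> carrier (G\<lparr>carrier := H\<rparr>)"
      have "k \<in> \<phi> ` H" using k by simp
      then obtain h where h: "h \<in> H" "k = \<phi> h" by blast
      have "k <# (\<phi> ` B) = \<phi> ` (h <# B)"
        unfolding lcos_eq_image image_image
      proof (intro image_cong refl)
        fix x assume "x \<in> B"
        then have "x \<in> carrier G" using B HG by auto
        moreover have "h \<in> carrier G" using h(1) HG by auto
        ultimately show "k \<otimes> \<phi> x = \<phi> (h \<otimes> x)" using mult[of h x] h(2) by simp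
      qed
      then show "\<exists>h\<in>carrier (G\<lparr>carrier := H\<rparr>).
          k <#\<^bsub>G\<lparr>carrier := \<phi> ` H\<rparr>\<^esub> (\<phi> ` B) = \<phi> ` (h <#\<^bsub>G\<lparr>carrier := H\<rparr>\<^esub> B)"
        using h(1) by (intro bexI[of _ h]) (simp_all add: l_coset_def)
    qed
  qed
  then show ?thesis unfolding img haar_scheme_def by (simp only: Setcompr_eq_image)
qed

section \<open>The ideal scheme of Haar null sets\<close>

lemma haar_scheme_strongly_admissible: "strongly_admissible G T (haar_scheme G T)"
proof -
  have sub: "sigma_compact_group (G\<lparr>carrier := H\<rparr>) (subtopology T H)" if "closed_subgroup G T H" for H
    by (rule closed_subgroup_sigma_compact_group[OF sigma_compact_group_axioms that])
  have closed_sub: "closed_subgroup (G\<lparr>carrier := H\<rparr>) (subtopology T H) K"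
    if "closed_subgroup G T H" "closed_subgroup G T K" "K \<subseteq> H" for H K
    using that subgroup_incl by (auto simp: closed_subgroup_def closedin_subset_topspace)
  have sigma: "scheme_sigma_ideal G T (haar_scheme G T)"
    unfolding scheme_sigma_ideal_def haar_scheme_def
    using sigma_compact_group.haar_null_sets_sigma_ideal[OF sub] by simp
  have "scheme_invariance G T (haar_scheme G T)"
    unfolding scheme_invariance_def
  proof (intro allI impI conjI ballI)
    fix H h X assume H: "closed_subgroup G T H" and h: "h \<in> H" and X: "X \<in> haar_scheme G T H"
    show "h <# X \<in> haar_scheme G T H"
      using sigma_compact_group.haar_null_lcos[OF sub[OF H], of h X] h X
      by (simp add: haar_scheme_def l_coset_def)
    show "X #> h \<in> haar_scheme G T H"
      using sigma_compact_group.haar_null_rcos[OF sub[OF H], of h X] h X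
      by (simp add: haar_scheme_def r_coset_def)
  qed (rule haar_scheme_conjugate)
  moreover have "scheme_transitivity G T (haar_scheme G T)"
    unfolding scheme_transitivity_def
  proof (intro allI impI, elim conjE)
    fix L K P H
    assume cl: "closed_subgroup G T L" "closed_subgroup G T K" "closed_subgroup G T P" "closed_subgroup G T H"
      and le: "P \<subseteq> K" "K \<subseteq> L" "H \<subseteq> L"
    have "subtopology (subtopology T L) K = subtopology T K"
      using le by (simp add: subtopology_subtopology Int_absorb1)
    then have "haar_scheme (G\<lparr>carrier := L\<rparr>) (subtopology T L) K = haar_scheme G T K"
      by (simp add: haar_scheme_def)
    moreover have "X <#>\<^bsub>G\<lparr>carrier := L\<rparr>\<^esub> Y = X <#> Y" for X Y by (simp add: set_mult_def)
    ultimately show "((H \<inter> K) <#> P \<notin> haar_scheme G T K \<and> H <#> K \<notin> haar_scheme G T L)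
        = (H <#> P \<notin> haar_scheme G T L)"
      using sigma_compact_group.haar_transitivity[OF sub[OF cl(1)],
          OF closed_sub[OF cl(1,2) le(2)] closed_sub[OF cl(1,3)] closed_sub[OF cl(1,4) le(3)] le(1)] le
      by (auto simp: haar_scheme_def)
  qed
  moreover have "scheme_dichotomy G T (haar_scheme G T)"
    unfolding scheme_dichotomy_def
    using sigma_compact_group.subgroup_null_iff_uncountable_index[OF sub closed_sub]
    by (auto simp: haar_scheme_def)
  ultimately show ?thesis
    using sigma by (auto simp: strongly_admissible_def ideal_scheme_def scheme_sigma_ideal_def set_sigma_ideal_def)
qed

end

theorem theorem7:
  fixes G :: "('a, 'b) monoid_scheme" and T :: "'a topology"
  assumes "topological_group G T"
    and "Hausdorff_space T"
    and "locally_compact_space T"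
    and "sigma_compact_space T"
  shows "strongly_admissible G T (haar_scheme G T) \<and>
    strongly_admissible_geometry G T
      (induced_independence G T (haar_scheme G T) ::
         'x set \<Rightarrow> ('a \<Rightarrow> 'x \<Rightarrow> 'x) \<Rightarrow> 'x set \<Rightarrow> 'x set \<Rightarrow> 'x set \<Rightarrow> bool)"
proof -
  interpret topological_group G T by fact
  interpret sigma_compact_group G T by unfold_locales (fact assms)+
  show ?thesis
    using haar_scheme_strongly_admissible unfolding strongly_admissible_geometry_def by blast
qed

end
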